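(* Up to integral equivalence, shard polytopes of type A are exactly the base polytopes of snake matroids: every shard polytope $\mathscr{SP}(\alpha)$ of type A is integrally equivalent to the base polytope of some snake matroid, and the base polytope of every snake matroid is integrally equivalent to some shard polytope of type A.
   Context: An arc is a tuple $\alpha=(a,b,A,B)$ with integers $1\le a<b\le n$ and $A\sqcup B=\{a+1,\dots,b-1\}$ a partition into two (possibly empty) disjoint sets. An $\alpha$-fall is a position $j\in\{a,\dots,b-1\}$ such that $j\in\{a\}\cup A$ and $j+1\in B\cup\{b\}$; an $\alpha$-rise is a position $j\in\{a,\dots,b-1\}$ such that $j\in\{a\}\cup B$ and $j+1\in A\cup\{b\}$. The shard polytope $\mathscr{SP}(\alpha)$ (of type A) is the set of $(x_1,\dots,x_n)\in\mathbb{R}^n$ with $\sum_{i=1}^n x_i=0$ satisfying: $x_i=0$ for $i\in\{1,\dots,n\}\setminus\{a,\dots,b\}$; $x_{a'}\ge 0$ for $a'\in A$ and $x_{b'}\le 0$ for $b'\in B$; $\sum_{i\le f}x_i\le 1$ for every $\alpha$-fall $f$; and $\sum_{i\le r}x_i\ge 0$ for every $\alpha$-rise $r$. For a matroid $\mathsf{M}$ on $\{1,\dots,N\}$ with set of bases $\mathcal{B}$, the base polytope is $\mathscr{P}(\mathsf{M})=\mathrm{conv}(e_C: C\in\mathcal{B})\subseteq\mathbb{R}^N$, where $e_C=\sum_{i\in C}e_i$. A lattice path matroid is defined as follows: fix lattice paths $P,Q$ from $(0,0)$ to $(m,r)$ using unit north and east steps with $P$ never going above $Q$; the ground set is $\{1,\dots,m+r\}$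 and the bases are the sets of positions of the north steps of the lattice paths from $(0,0)$ to $(m,r)$ that stay weakly between $P$ and $Q$. A snake matroid is a matroid that (i) has at least two elements and is connected, (ii) is isomorphic to a lattice path matroid, and (iii) has no minor isomorphic to the uniform matroid $\mathsf{U}_{2,4}$. Two lattice polytopes $\mathscr{P}\subseteq\mathbb{R}^p$, $\mathscr{Q}\subseteq\mathbb{R}^q$ are integrally equivalent if there is an affine bijection between their affine spans mapping $\mathscr{P}$ onto $\mathscr{Q}$ and mapping $\mathrm{aff}(\mathscr{P})\cap\mathbb{Z}^p$ bijectively onto $\mathrm{aff}(\mathscr{Q})\cap\mathbb{Z}^q$. *)

theory Defs
  imports "HOL-Analysis.Analysis" "HOL-Analysis.Finite_Function_Topology"
begin

text \<open>
  The dimensions of the two polytopes being compared vary independently inside the statement,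
  so \<open>\<real>\<^sup>p\<close> is rendered as the subspace \<open>coord_space p\<close> of the real vector space of finitely
  supported functions \<open>nat \<Rightarrow>\<^sub>0 real\<close>, with coordinates indexed by \<open>1, \<dots>, p\<close>.  Convex and affine
  hulls are those of the library and do not depend on the ambient space.
\<close>

section \<open>Integral equivalence of lattice polytopes\<close>

type_synonym vec_fin = "nat \<Rightarrow>\<^sub>0 real"

definition coord_space :: "nat \<Rightarrow> vec_fin set" where
  "coord_space p = {x. Poly_Mapping.keys x \<subseteq> {1..p}}"

definition int_lattice :: "nat \<Rightarrow> vec_fin set" where
  "int_lattice p = {x \<in> coord_space p. \<forall>i. Poly_Mapping.lookup x i \<in> \<int>}"

definition lattice_polytope :: "nat \<Rightarrow> vec_fin set \<Rightarrow> bool" where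
  "lattice_polytope p P \<longleftrightarrow> (\<exists>V. finite V \<and> V \<subseteq> int_lattice p \<and> P = convex hull V)"

text \<open>The domain \<open>S\<close> is intended to be an affine subspace.\<close>

definition affine_map_on :: "'a::real_vector set \<Rightarrow> ('a \<Rightarrow> 'b::real_vector) \<Rightarrow> bool" where
  "affine_map_on S f \<longleftrightarrow>
     (\<forall>x\<in>S. \<forall>y\<in>S. \<forall>t::real. f ((1 - t) *\<^sub>R x + t *\<^sub>R y) = (1 - t) *\<^sub>R f x + t *\<^sub>R f y)"

definition integrally_equivalent ::
  "nat \<Rightarrow> vec_fin set \<Rightarrow> nat \<Rightarrow> vec_fin set \<Rightarrow> bool" where
  "integrally_equivalent p P q Q \<longleftrightarrow>
     lattice_polytope p P \<and> lattice_polytope q Q \<and>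
     (\<exists>f. affine_map_on (affine hull P) f \<and>
          bij_betw f (affine hull P) (affine hull Q) \<and>
          f ` P = Q \<and>
          bij_betw f (affine hull P \<inter> int_lattice p) (affine hull Q \<inter> int_lattice q))"


section \<open>Shard polytopes of type A\<close>

definition shard_arc :: "nat \<Rightarrow> nat \<Rightarrow> nat \<Rightarrow> nat set \<Rightarrow> nat set \<Rightarrow> bool" where
  "shard_arc n a b A B \<longleftrightarrow>
     1 \<le> a \<and> a < b \<and> b \<le> n \<and> A \<union> B = {a+1..b-1} \<and> A \<inter> B = {}"

definition arc_falls :: "nat \<Rightarrow> nat \<Rightarrow> nat set \<Rightarrow> nat set \<Rightarrow> nat set" where
  "arc_falls a b A B = {j \<in> {a..b-1}. j \<in> {a} \<union> A \<and> j + 1 \<in> B \<union> {b}}"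

definition arc_rises :: "nat \<Rightarrow> nat \<Rightarrow> nat set \<Rightarrow> nat set \<Rightarrow> nat set" where
  "arc_rises a b A B = {j \<in> {a..b-1}. j \<in> {a} \<union> B \<and> j + 1 \<in> A \<union> {b}}"

definition shard_polytope :: "nat \<Rightarrow> nat \<Rightarrow> nat \<Rightarrow> nat set \<Rightarrow> nat set \<Rightarrow> vec_fin set" where
  "shard_polytope n a b A B =
     {x \<in> coord_space n.
        (\<Sum>i=1..n. Poly_Mapping.lookup x i) = 0 \<and>
        (\<forall>i\<in>{1..n} - {a..b}. Poly_Mapping.lookup x i = 0) \<and>
        (\<forall>i\<in>A. Poly_Mapping.lookup x i \<ge> 0) \<and>
        (\<forall>i\<in>B. Poly_Mapping.lookup x i \<le> 0) \<and>
        (\<forall>f\<in>arc_falls a b A B. (\<Sum>i=1..f. Poly_Mapping.lookup x i) \<le> 1) \<and>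
        (\<forall>r\<in>arc_rises a b A B. (\<Sum>i=1..r. Poly_Mapping.lookup x i) \<ge> 0)}"


section \<open>Matroids\<close>

record 'a basis_system =
  ground :: "'a set"
  bases :: "'a set set"

definition matroid :: "'a basis_system \<Rightarrow> bool" where
  "matroid M \<longleftrightarrow>
     finite (ground M) \<and> bases M \<noteq> {} \<and> (\<forall>C\<in>bases M. C \<subseteq> ground M) \<and>
     (\<forall>C\<in>bases M. \<forall>D\<in>bases M. \<forall>x\<in>C - D. \<exists>y\<in>D - C. insert y (C - {x}) \<in> bases M)"

definition matroid_isomorphic :: "'a basis_system \<Rightarrow> 'b basis_system \<Rightarrow> bool" where
  "matroid_isomorphic M N \<longleftrightarrow>
     (\<exists>f. bij_betw f (ground M) (ground N) \<and> bases N = (\<lambda>C. f ` C) ` bases M)"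

definition direct_sum :: "'a basis_system \<Rightarrow> 'a basis_system \<Rightarrow> 'a basis_system" where
  "direct_sum M N =
     \<lparr>ground = ground M \<union> ground N, bases = {C \<union> D |C D. C \<in> bases M \<and> D \<in> bases N}\<rparr>"

definition connected_matroid :: "'a basis_system \<Rightarrow> bool" where
  "connected_matroid M \<longleftrightarrow>
     \<not> (\<exists>M\<^sub>1 M\<^sub>2. matroid M\<^sub>1 \<and> matroid M\<^sub>2 \<and> ground M\<^sub>1 \<noteq> {} \<and> ground M\<^sub>2 \<noteq> {} \<and>
          ground M\<^sub>1 \<inter> ground M\<^sub>2 = {} \<and> M = direct_sum M\<^sub>1 M\<^sub>2)"

definition independent_sets :: "'a basis_system \<Rightarrow> 'a set set" where
  "independent_sets M = {I. \<exists>C\<in>bases M. I \<subseteq> C}"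

definition dual_matroid :: "'a basis_system \<Rightarrow> 'a basis_system" where
  "dual_matroid M = \<lparr>ground = ground M, bases = (\<lambda>C. ground M - C) ` bases M\<rparr>"

definition deletion :: "'a basis_system \<Rightarrow> 'a set \<Rightarrow> 'a basis_system" where
  "deletion M X =
     \<lparr>ground = ground M - X,
      bases = {I. I \<in> independent_sets M \<and> I \<subseteq> ground M - X \<and>
                  (\<forall>J. J \<in> independent_sets M \<and> J \<subseteq> ground M - X \<and> I \<subseteq> J \<longrightarrow> J = I)}\<rparr>"

definition contraction :: "'a basis_system \<Rightarrow> 'a set \<Rightarrow> 'a basis_system" where
  "contraction M X = dual_matroid (deletion (dual_matroid M) X)"

definition is_minor :: "'a basis_system \<Rightarrow> 'a basis_system \<Rightarrow> bool" where
  "is_minor N M \<longleftrightarrow>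
     (\<exists>X Y. X \<subseteq> ground M \<and> Y \<subseteq> ground M \<and> X \<inter> Y = {} \<and> N = deletion (contraction M X) Y)"

definition uniform_matroid :: "nat \<Rightarrow> nat \<Rightarrow> nat basis_system" where
  "uniform_matroid k N = \<lparr>ground = {1..N}, bases = {C. C \<subseteq> {1..N} \<and> card C = k}\<rparr>"

definition base_polytope :: "nat basis_system \<Rightarrow> vec_fin set" where
  "base_polytope M = convex hull ((\<lambda>C. \<Sum>i\<in>C. Poly_Mapping.single i 1) ` bases M)"


section \<open>Lattice path matroids and snake matroids\<close>

datatype step = North | East

text \<open>A lattice path starting at \<open>(0,0)\<close> is encoded by its word of steps.\<close>

definition lattice_path :: "nat \<Rightarrow> nat \<Rightarrow> step list \<Rightarrow> bool" where
  "lattice_path m r w \<longleftrightarrow> count_list w East = m \<and> count_list w North = r"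

text \<open>
  After \<open>k\<close> steps every path is on the antidiagonal \<open>x + y = k\<close>; one path never goes above another
  with the same endpoints iff on each antidiagonal its point is at most as high.
\<close>

definition height :: "step list \<Rightarrow> nat \<Rightarrow> nat" where
  "height w k = count_list (take k w) North"

definition never_above :: "step list \<Rightarrow> step list \<Rightarrow> bool" where
  "never_above v w \<longleftrightarrow> (\<forall>k. height v k \<le> height w k)"

definition north_positions :: "step list \<Rightarrow> nat set" where
  "north_positions w = {i \<in> {1..length w}. w ! (i - 1) = North}"

definition lattice_path_matroid_of ::
  "nat \<Rightarrow> nat \<Rightarrow> step list \<Rightarrow> step list \<Rightarrow> nat basis_system" where
  "lattice_path_matroid_of m r P Q =
     \<lparr>ground = {1..m + r},
      bases = {north_positions w |w. lattice_path m r w \<and> never_above P w \<and> never_above w Q}\<rparr>"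

definition lattice_path_matroid :: "nat basis_system \<Rightarrow> bool" where
  "lattice_path_matroid L \<longleftrightarrow>
     (\<exists>m r P Q. lattice_path m r P \<and> lattice_path m r Q \<and> never_above P Q \<and>
        L = lattice_path_matroid_of m r P Q)"

definition snake_matroid :: "'a basis_system \<Rightarrow> bool" where
  "snake_matroid M \<longleftrightarrow>
     matroid M \<and> card (ground M) \<ge> 2 \<and> connected_matroid M \<and>
     (\<exists>L. lattice_path_matroid L \<and> matroid_isomorphic M L) \<and>
     \<not> (\<exists>N. is_minor N M \<and> matroid_isomorphic N (uniform_matroid 2 4))"

end

theory Submission
  imports Defs
begin

text \<open>
  Both polytopes are order polytopes of the same zigzag posets, and in suitable coordinates they are
  translates of each other.

  On the side of shard polytopes, pass from \<open>x\<close> to its partial sums \<open>s\<^sub>k = x\<^sub>1 + \<dots> + x\<^sub>k\<close>.  The sign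
  conditions say that \<open>s\<close> increases along \<open>A\<close> and decreases along \<open>B\<close>, so its local maxima and minima
  between \<open>a\<close> and \<open>b - 1\<close> are at the falls and at the rises, and the remaining inequalities say that \<open>s\<close>
  takes values in \<open>[0,1]\<close> there and vanishes outside (\<open>shard_polytope_iff\<close>).  Such a polytope is the
  convex hull of its lattice points (\<open>order_polytope_integral\<close>, \<open>shard_polytope_integral\<close>).  At a lattice
  point the partial sums are \<open>0\<close> or \<open>1\<close>, and these are the differences between the heights of two lattice
  paths with the same endpoints: a fixed one with north steps at \<open>T = B \<union> {b}\<close>, and one that is never below
  it and at most one unit above it (\<open>shard_lattice_points\<close>).  Hence the lattice points are the vectors
  \<open>e\<^sub>C - e\<^sub>T\<close>, where \<open>C\<close> ranges over the bases of a lattice path matroid whose boundary paths are at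
  distance exactly one strictly between their endpoints, and translation by \<open>e\<^sub>T\<close> is the integral
  equivalence.

  It remains to see that the lattice path matroids of this shape are the snake matroids.  If the boundary
  paths meet between their endpoints, then the matroid is a direct sum (\<open>path_matroid_separator\<close>); if
  their distance reaches two, then there is a minor \<open>U(2,4)\<close> (\<open>path_matroid_u24\<close>).  Conversely, distance one
  implies connectedness (\<open>snake_matroid_snake_path_matroid\<close>) and excludes such a minor
  (\<open>path_matroid_no_u24\<close>).  To handle minors and direct sums, both are first expressed by conditions on the
  family of bases: in \<open>M\<close>, a minor \<open>U(2,4)\<close> amounts to four elements all of whose pairs become bases after
  adding one fixed set (\<open>u24_configuration\<close>), and a decomposition as a direct sum amounts to a subset of the
  ground set along which any two bases can be glued (\<open>separator\<close>).
\<close>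

section \<open>Bases, duality and minors\<close>

lemma basis_subset: "matroid M \<Longrightarrow> C \<in> bases M \<Longrightarrow> C \<subseteq> ground M"
  unfolding matroid_def by blast

lemma finite_ground: "matroid M \<Longrightarrow> finite (ground M)"
  unfolding matroid_def by blast

lemma ex_basis: "matroid M \<Longrightarrow> \<exists>C. C \<in> bases M"
  unfolding matroid_def by (meson ex_in_conv)

lemma matroidI:
  assumes "finite (ground M)" "C0 \<in> bases M" "\<And>C. C \<in> bases M \<Longrightarrow> C \<subseteq> ground M"
    and "\<And>C D x. C \<in> bases M \<Longrightarrow> D \<in> bases M \<Longrightarrow> x \<in> C - D \<Longrightarrow>
           \<exists>y\<in>D - C. insert y (C - {x}) \<in> bases M"
  shows "matroid M"
  unfolding matroid_def
  by (intro conjI ballI) (use assms in blast)+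

lemma finite_basis: "matroid M \<Longrightarrow> C \<in> bases M \<Longrightarrow> finite C"
  unfolding matroid_def by (meson finite_subset)

lemma basis_exchange:
  assumes "matroid M" "C \<in> bases M" "D \<in> bases M" "x \<in> C - D"
  obtains y where "y \<in> D - C" "insert y (C - {x}) \<in> bases M"
  using assms unfolding matroid_def by blast

lemma basis_antichain:
  assumes "matroid M" "C \<in> bases M" "D \<in> bases M" "C \<subseteq> D"
  shows "C = D"
proof (rule ccontr)
  assume "C \<noteq> D"
  then obtain x where "x \<in> D - C" using assms(4) by blast
  then show False using basis_exchange[OF assms(1,3,2)] assms(4) by blast
qed

lemma card_exchange:
  assumes "finite C" "x \<in> C" "y \<notin> C"
  shows "card (insert y (C - {x})) = card C"
  using assms card_Suc_Diff1[of C x] by simp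

lemma bases_equicardinal:
  assumes M: "matroid M" and "C \<in> bases M" and D: "D \<in> bases M"
  shows "card C = card D"
  using assms(2)
proof (induction "card (C - D)" arbitrary: C rule: less_induct)
  case less
  show ?case
  proof (cases "C \<subseteq> D")
    case True
    then show ?thesis using basis_antichain[OF M less.prems D] by simp
  next
    case False
    then obtain x where x: "x \<in> C - D" by blast
    obtain y where y: "y \<in> D - C" and B: "insert y (C - {x}) \<in> bases M"
      using basis_exchange[OF M less.prems D x] .
    have fin: "finite C" using finite_basis[OF M less.prems] .
    have "insert y (C - {x}) - D = (C - D) - {x}" using y by blast
    then have "card (insert y (C - {x}) - D) < card (C - D)"
      using x fin by (metis card_Diff1_less finite_Diff)
    from less.hyps[OF this B] have "card (insert y (C - {x})) = card D" .
    moreover have "card (insert y (C - {x})) = card C"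
      using x y fin by (intro card_exchange) auto
    ultimately show ?thesis by simp
  qed
qed

text \<open>
  Starting from \<open>D\<close>, elements outside \<open>C \<union> I\<close> can be exchanged for elements of \<open>C\<close> one at a time;
  none of these exchanges removes an element of \<open>I\<close>.
\<close>

lemma basis_extension:
  assumes M: "matroid M" and C: "C \<in> bases M" and "D \<in> bases M" "I \<subseteq> D"
  shows "\<exists>D'\<in>bases M. I \<subseteq> D' \<and> D' \<subseteq> C \<union> I"
  using assms(3,4)
proof (induction "card (D - (C \<union> I))" arbitrary: D rule: less_induct)
  case less
  show ?case
  proof (cases "D \<subseteq> C \<union> I")
    case True
    then show ?thesis using less.prems by blast
  next
    case False
    then obtain x where x: "x \<in> D - (C \<union> I)" by blast
    then have "x \<in> D - C" by blast
    then obtain y where y: "y \<in> C - D" and B: "insert y (D - {x}) \<in> bases M"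
      using basis_exchange[OF M less.prems(1) C] by blast
    have "insert y (D - {x}) - (C \<union> I) = (D - (C \<union> I)) - {x}" using y by blast
    then have "card (insert y (D - {x}) - (C \<union> I)) < card (D - (C \<union> I))"
      using x finite_basis[OF M less.prems(1)] by (metis card_Diff1_less finite_Diff)
    from less.hyps[OF this B] show ?thesis using less.prems(2) x by blast
  qed
qed

lemma ground_deletion [simp]: "ground (deletion M Y) = ground M - Y"
  by (simp add: deletion_def)

lemma ground_dual [simp]: "ground (dual_matroid M) = ground M"
  by (simp add: dual_matroid_def)

lemma ground_contraction [simp]: "ground (contraction M X) = ground M - X"
  by (simp add: contraction_def)

lemma bases_dual: "bases (dual_matroid M) = (\<lambda>C. ground M - C) ` bases M"
  by (simp add: dual_matroid_def)

text \<open>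
  The exchange property of the dual says that an element \<open>x \<in> D - C\<close> can be added to \<open>C\<close> at the cost
  of some element of \<open>C - D\<close>.  Extending the independent set \<open>insert x (C \<inter> D)\<close> inside
  \<open>insert x C\<close> gives a basis that differs from \<open>C\<close> in one element only, and that element lies
  outside \<open>D\<close>.
\<close>

lemma matroid_dual_matroid:
  assumes M: "matroid M"
  shows "matroid (dual_matroid M)"
proof -
  let ?E = "ground M"
  have "\<exists>y\<in>(?E - D) - (?E - C). insert y ((?E - C) - {x}) \<in> (\<lambda>C. ?E - C) ` bases M"
    if C: "C \<in> bases M" and D: "D \<in> bases M" and x: "x \<in> (?E - C) - (?E - D)" for C D x
  proof -
    have xD: "x \<in> D - C" using x by blast
    have "insert x (C \<inter> D) \<subseteq> D" using xD by blast
    from basis_extension[OF M C D this] obtain C' where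
      C': "C' \<in> bases M" "insert x (C \<inter> D) \<subseteq> C'" "C' \<subseteq> insert x C" by auto
    have "\<not> C \<subseteq> C'" using basis_antichain[OF M C C'(1)] C'(2) xD by blast
    then obtain y where y: "y \<in> C" "y \<notin> C'" by blast
    have sub: "C' \<subseteq> insert x (C - {y})" using C' y by blast
    have finC: "finite C" using finite_basis[OF M C] .
    have "card (insert x (C - {y})) = card C"
      using xD y finC by (intro card_exchange) auto
    then have "card C' = card (insert x (C - {y}))"
      using bases_equicardinal[OF M C C'(1)] by (rule trans[symmetric])
    then have "C' = insert x (C - {y})"
      using finC by (intro card_subset_eq[OF _ sub]) simp_all
    moreover have "insert y ((?E - C) - {x}) = ?E - insert x (C - {y})"
      using y xD basis_subset[OF M C] by blast
    moreover have "y \<in> (?E - D) - (?E - C)" using y C'(2) basis_subset[OF M C] by blast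
    ultimately show ?thesis using C'(1) by blast
  qed
  note exch = this
  obtain C0 where C0: "C0 \<in> bases M" using ex_basis[OF M] by blast
  show ?thesis
  proof (rule matroidI)
    show "finite (ground (dual_matroid M))" using finite_ground[OF M] by simp
    show "?E - C0 \<in> bases (dual_matroid M)" using C0 unfolding bases_dual by blast
    show "C \<subseteq> ground (dual_matroid M)" if "C \<in> bases (dual_matroid M)" for C
      using that unfolding bases_dual by auto
    show "\<exists>y\<in>D' - C'. insert y (C' - {x}) \<in> bases (dual_matroid M)"
      if "C' \<in> bases (dual_matroid M)" "D' \<in> bases (dual_matroid M)" "x \<in> C' - D'" for C' D' x
    proof -
      from that(1) obtain C where C: "C \<in> bases M" "C' = ?E - C" unfolding bases_dual by (rule imageE)
      from that(2) obtain D where D: "D \<in> bases M" "D' = ?E - D" unfolding bases_dual by (rule imageE)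
      from exch[OF C(1) D(1), of x] that(3) show ?thesis unfolding bases_dual C(2) D(2) .
    qed
  qed
qed

text \<open>
  A basis \<open>C0\<close> that meets \<open>Y\<close> as little as possible contributes the same part \<open>C0 \<inter> Y\<close> to all
  maximal independent sets avoiding \<open>Y\<close>, so the deletion is described by a membership condition in
  \<open>bases M\<close> with no maximality left in it.
\<close>

lemma bases_deletion:
  assumes M: "matroid M" and C0: "C0 \<in> bases M"
    and max: "\<forall>C\<in>bases M. card (C - Y) \<le> card (C0 - Y)"
  shows "bases (deletion M Y) = {K. K \<subseteq> ground M - Y \<and> K \<union> (C0 \<inter> Y) \<in> bases M}"
proof (intro set_eqI iffI)
  fix K assume "K \<in> bases (deletion M Y)"
  then have K: "K \<subseteq> ground M - Y" and ind: "K \<in> independent_sets M"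
    and mx: "\<And>J. J \<in> independent_sets M \<Longrightarrow> J \<subseteq> ground M - Y \<Longrightarrow> K \<subseteq> J \<Longrightarrow> J = K"
    unfolding deletion_def by auto
  obtain C where C: "C \<in> bases M" "K \<subseteq> C" using ind unfolding independent_sets_def by blast
  obtain D where D: "D \<in> bases M" "K \<subseteq> D" "D \<subseteq> C0 \<union> K"
    using basis_extension[OF M C0 C] by blast
  have DK: "D - Y = K"
    using mx[of "D - Y"] D K basis_subset[OF M D(1)] unfolding independent_sets_def by blast
  have fin: "finite C0" "finite D" using finite_basis[OF M] C0 D by auto
  have "card D = card (D - Y) + card (D \<inter> Y)" "card C0 = card (C0 - Y) + card (C0 \<inter> Y)"
    using fin by (metis card_Int_Diff add.commute)+
  then have "card (C0 \<inter> Y) \<le> card (D \<inter> Y)"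
    using bspec[OF max D(1)] bases_equicardinal[OF M C0 D(1)] by linarith
  moreover have "D \<inter> Y \<subseteq> C0 \<inter> Y" using D K by blast
  ultimately have "D \<inter> Y = C0 \<inter> Y" using card_seteq[of "C0 \<inter> Y" "D \<inter> Y"] fin by simp
  then have "K \<union> (C0 \<inter> Y) = D" using DK by blast
  then show "K \<in> {K. K \<subseteq> ground M - Y \<and> K \<union> (C0 \<inter> Y) \<in> bases M}" using D K by simp
next
  fix K assume "K \<in> {K. K \<subseteq> ground M - Y \<and> K \<union> (C0 \<inter> Y) \<in> bases M}"
  then have K: "K \<subseteq> ground M - Y" and B: "K \<union> (C0 \<inter> Y) \<in> bases M" by auto
  have fin: "finite C0" "finite K" using finite_basis[OF M C0] finite_basis[OF M B] by auto
  have "card (K \<union> (C0 \<inter> Y)) = card K + card (C0 \<inter> Y)"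
    using fin K by (intro card_Un_disjoint) auto
  moreover have "card C0 = card (C0 - Y) + card (C0 \<inter> Y)"
    using fin by (metis card_Int_Diff add.commute)
  ultimately have cK: "card K = card (C0 - Y)" using bases_equicardinal[OF M C0 B] by linarith
  have "J = K" if J: "J \<in> independent_sets M" "J \<subseteq> ground M - Y" "K \<subseteq> J" for J
  proof -
    obtain C where C: "C \<in> bases M" "J \<subseteq> C" using J unfolding independent_sets_def by blast
    have "J \<subseteq> C - Y" using J C by blast
    then have "card J \<le> card (C - Y)" using finite_basis[OF M C(1)] by (simp add: card_mono)
    then have "card J \<le> card K" using bspec[OF max C(1)] cK by linarith
    then show ?thesis using card_seteq[of J K] J C finite_basis[OF M C(1)] finite_subset by blast
  qed
  then show "K \<in> bases (deletion M Y)"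
    using K B unfolding deletion_def independent_sets_def by auto
qed

lemma ex_basis_maximizing:
  assumes M: "matroid M"
  obtains C0 where "C0 \<in> bases M" "\<forall>C\<in>bases M. card (C - Y) \<le> card (C0 - Y)"
proof -
  obtain C where C: "C \<in> bases M" using ex_basis[OF M] by blast
  have "card (D - Y) \<le> card (ground M)" if "D \<in> bases M" for D
    using basis_subset[OF M that] by (intro card_mono[OF finite_ground[OF M]]) blast
  then have "\<exists>C0. C0 \<in> bases M \<and> (\<forall>D. D \<in> bases M \<longrightarrow> card (D - Y) \<le> card (C0 - Y))"
    using C by (intro ex_has_greatest_nat[where k = C and b = "Suc (card (ground M))"])
      (auto simp: less_Suc_eq_le)
  then show thesis using that by blast
qed

lemma matroid_deletion:
  assumes M: "matroid M"
  shows "matroid (deletion M Y)"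
proof -
  obtain C0 where C0: "C0 \<in> bases M"
    and max: "\<forall>C\<in>bases M. card (C - Y) \<le> card (C0 - Y)"
    using ex_basis_maximizing[OF M] by blast
  note B = bases_deletion[OF M C0 max]
  have "C0 - Y \<in> bases (deletion M Y)"
    unfolding B using C0 basis_subset[OF M C0] by (auto simp: Un_Diff_Int)
  moreover have "\<exists>y\<in>D - C. insert y (C - {x}) \<in> bases (deletion M Y)"
    if C: "C \<in> bases (deletion M Y)" and D: "D \<in> bases (deletion M Y)" and x: "x \<in> C - D" for C D x
  proof -
    have C': "C \<subseteq> ground M - Y" "C \<union> (C0 \<inter> Y) \<in> bases M" using C unfolding B by auto
    have D': "D \<subseteq> ground M - Y" "D \<union> (C0 \<inter> Y) \<in> bases M" using D unfolding B by auto
    have "x \<in> (C \<union> (C0 \<inter> Y)) - (D \<union> (C0 \<inter> Y))" using x C' by blast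
    from basis_exchange[OF M C'(2) D'(2) this] obtain y where
      y: "y \<in> D - C" "insert y ((C \<union> (C0 \<inter> Y)) - {x}) \<in> bases M" by blast
    have "insert y ((C \<union> (C0 \<inter> Y)) - {x}) = insert y (C - {x}) \<union> (C0 \<inter> Y)"
      using x C' by blast
    then show ?thesis using y C' D' unfolding B by auto
  qed
  moreover have "finite (ground (deletion M Y))" using finite_ground[OF M] by simp
  moreover have "C \<subseteq> ground (deletion M Y)" if "C \<in> bases (deletion M Y)" for C
    using that unfolding B by simp
  ultimately show ?thesis by (intro matroidI) assumption+
qed

text \<open>
  The dual of the description of deletions: now \<open>C0\<close> meets \<open>X\<close> as much as possible.
\<close>

lemma bases_contraction:
  assumes M: "matroid M" and C0: "C0 \<in> bases M"
    and max: "\<forall>C\<in>bases M. card (C \<inter> X) \<le> card (C0 \<inter> X)"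
    and X: "X \<subseteq> ground M"
  shows "bases (contraction M X) = {J. J \<subseteq> ground M - X \<and> J \<union> (C0 \<inter> X) \<in> bases M}"
proof -
  let ?E = "ground M"
  have finE: "finite ?E" using finite_ground[OF M] .
  have compl: "card ((?E - C) - X) + card C = card (?E - X) + card (C \<inter> X)" if "C \<in> bases M" for C
  proof -
    have C: "C \<subseteq> ?E" "finite C" using that M basis_subset finite_basis by auto
    have "card C = card (C \<inter> X) + card (C - X)" using C by (simp add: card_Int_Diff)
    moreover have "card (?E - X) = card ((?E - X) \<inter> C) + card (?E - X - C)"
      using finE by (simp add: card_Int_Diff)
    moreover have "(?E - X) \<inter> C = C - X" "?E - X - C = ?E - C - X" using C by auto
    ultimately show ?thesis by simp
  qed
  have dual0: "?E - C0 \<in> bases (dual_matroid M)" using C0 by (simp add: bases_dual)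
  have dmax: "\<forall>C\<in>bases (dual_matroid M). card (C - X) \<le> card (?E - C0 - X)"
  proof
    fix C assume that: "C \<in> bases (dual_matroid M)"
    from that obtain D where D: "D \<in> bases M" "C = ?E - D" unfolding bases_dual by (rule imageE)
    then show "card (C - X) \<le> card (?E - C0 - X)"
      using compl[OF D(1)] compl[OF C0] bspec[OF max D(1)] bases_equicardinal[OF M D(1) C0] by simp
  qed
  note del = bases_deletion[OF matroid_dual_matroid[OF M] dual0 dmax]
  have bC: "bases (contraction M X) =
      (\<lambda>K. (?E - X) - K) ` {K. K \<subseteq> ?E - X \<and> K \<union> ((?E - C0) \<inter> X) \<in> bases (dual_matroid M)}"
    unfolding contraction_def bases_dual[of "deletion _ _"] del by simp
  have "J \<in> bases (contraction M X) \<longleftrightarrow> J \<subseteq> ?E - X \<and> J \<union> (C0 \<inter> X) \<in> bases M" for J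
  proof -
    have "J \<in> bases (contraction M X) \<longleftrightarrow>
        (\<exists>K. J = (?E - X) - K \<and> K \<subseteq> ?E - X \<and> K \<union> ((?E - C0) \<inter> X) \<in> (\<lambda>C. ?E - C) ` bases M)"
      unfolding bC bases_dual image_def[of _ "Collect _"] by blast
    also have "\<dots> \<longleftrightarrow> J \<subseteq> ?E - X \<and> J \<union> (C0 \<inter> X) \<in> bases M" (is "?l \<longleftrightarrow> ?r")
    proof
      assume ?l
      then obtain K C where K: "J = (?E - X) - K" "K \<subseteq> ?E - X"
        "K \<union> ((?E - C0) \<inter> X) = ?E - C" "C \<in> bases M" by blast
      have "C \<subseteq> ?E" using basis_subset[OF M K(4)] .
      then have "C = ?E - (K \<union> ((?E - C0) \<inter> X))" using K(3) by blast
      then have "C = J \<union> (C0 \<inter> X)" using K(1,2) X basis_subset[OF M C0] by blast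
      then show ?r using K by blast
    next
      assume r: ?r
      have "((?E - X) - J) \<union> ((?E - C0) \<inter> X) = ?E - (J \<union> (C0 \<inter> X))"
        using r X by blast
      then show ?l using r by (intro exI[of _ "?E - X - J"]) auto
    qed
    finally show ?thesis .
  qed
  then show ?thesis by blast
qed

lemma matroid_contraction: "matroid M \<Longrightarrow> matroid (contraction M X)"
  by (simp add: contraction_def matroid_deletion matroid_dual_matroid)

section \<open>Minors isomorphic to U(2,4)\<close>

text \<open>
  The trace in \<open>bases M\<close> of a minor isomorphic to \<open>U(2,4)\<close> on the ground set \<open>S\<close>: up to
  adding one fixed set \<open>Z\<close>, all pairs of elements of \<open>S\<close> are bases.  Both the absence
  and the existence of such a minor are established through this condition, which mentions neither
  deletion nor contraction and is visibly preserved by isomorphisms.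
\<close>

definition u24_configuration :: "'a basis_system \<Rightarrow> 'a set \<Rightarrow> 'a set \<Rightarrow> bool" where
  "u24_configuration M S Z \<longleftrightarrow> S \<subseteq> ground M \<and> card S = 4 \<and> Z \<subseteq> ground M - S \<and>
     (\<forall>K. K \<subseteq> S \<and> card K = 2 \<longrightarrow> K \<union> Z \<in> bases M)"

text \<open>
  The set \<open>Z\<close> collects the parts that the descriptions of deletion and contraction add back.
\<close>

lemma u24_minor_imp_configuration:
  assumes M: "matroid M" and N: "is_minor N M" "matroid_isomorphic N (uniform_matroid 2 4)"
  shows "\<exists>S Z. u24_configuration M S Z"
proof -
  obtain X Y where XY: "X \<subseteq> ground M" "Y \<subseteq> ground M" "X \<inter> Y = {}"
    and Nd: "N = deletion (contraction M X) Y" using N unfolding is_minor_def by blast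
  have mC: "matroid (contraction M X)" using matroid_contraction[OF M] .
  obtain D0 where D0: "D0 \<in> bases (contraction M X)"
    "\<forall>C\<in>bases (contraction M X). card (C - Y) \<le> card (D0 - Y)"
    using ex_basis_maximizing[OF mC] by blast
  obtain C0 where C0: "C0 \<in> bases M"
    "\<forall>C\<in>bases M. card (C - (- X)) \<le> card (C0 - (- X))"
    using ex_basis_maximizing[OF M] by blast
  have int: "C - (- X) = C \<inter> X" for C by blast
  note bC = bases_contraction[OF M C0(1) C0(2)[unfolded int] XY(1)]
  note bD = bases_deletion[OF mC D0]
  define Z where "Z = (D0 \<inter> Y) \<union> (C0 \<inter> X)"
  have bN: "K \<union> Z \<in> bases M" if "K \<in> bases N" for K
    using that unfolding Nd bD bC Z_def by (auto simp: Un_assoc)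
  obtain f where f: "bij_betw f (ground N) {1..4::nat}"
    and fb: "{C. C \<subseteq> {1..4::nat} \<and> card C = 2} = (\<lambda>C. f ` C) ` bases N"
    using N(2) unfolding matroid_isomorphic_def uniform_matroid_def by auto
  have gN: "ground N = ground M - X - Y" by (simp add: Nd)
  have "u24_configuration M (ground N) Z" unfolding u24_configuration_def
  proof (intro conjI allI impI)
    show "ground N \<subseteq> ground M" "Z \<subseteq> ground M - ground N" using XY by (auto simp: gN Z_def)
    show "card (ground N) = 4" using bij_betw_same_card[OF f] by simp
    fix K assume K: "K \<subseteq> ground N \<and> card K = 2"
    have inj: "inj_on f (ground N)" using f by (rule bij_betw_imp_inj_on)
    have "f ` K \<subseteq> {1..4}" using f K unfolding bij_betw_def by blast
    moreover have "card (f ` K) = 2" using K inj by (metis card_image inj_on_subset)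
    ultimately have "f ` K \<in> (\<lambda>C. f ` C) ` bases N" unfolding fb[symmetric] by blast
    then obtain K' where K': "K' \<in> bases N" "f ` K = f ` K'" by (rule imageE)
    have "K' \<subseteq> ground N"
      using K'(1) basis_subset[OF matroid_deletion[OF mC]] unfolding Nd by blast
    then have "K = K'" using K K'(2) inj by (meson inj_on_image_eq_iff)
    then show "K \<union> Z \<in> bases M" using bN K' by blast
  qed
  then show ?thesis by blast
qed

text \<open>
  Contract \<open>Z\<close> and delete everything outside \<open>S \<union> Z\<close>.
\<close>

lemma u24_configuration_imp_minor:
  assumes M: "matroid M" and SZ: "u24_configuration M S Z"
  shows "\<exists>N. is_minor N M \<and> matroid_isomorphic N (uniform_matroid 2 4)"
proof -
  have S: "S \<subseteq> ground M" "card S = 4" and Z: "Z \<subseteq> ground M - S"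
    and pairs: "\<And>K. K \<subseteq> S \<Longrightarrow> card K = 2 \<Longrightarrow> K \<union> Z \<in> bases M"
    using SZ unfolding u24_configuration_def by auto
  have finE: "finite (ground M)" using finite_ground[OF M] .
  have finS: "finite S" using S finE finite_subset by blast
  obtain K0 where K0: "K0 \<subseteq> S" "card K0 = 2" using obtain_subset_with_card_n[of 2 S] S(2) by force
  define Y where "Y = ground M - Z - S"
  define N where "N = deletion (contraction M Z) Y"
  have C0: "K0 \<union> Z \<in> bases M" using pairs K0 by blast
  have "\<forall>C\<in>bases M. card (C \<inter> Z) \<le> card ((K0 \<union> Z) \<inter> Z)"
    using Z finE by (intro ballI card_mono) (auto intro: finite_subset)
  moreover have "Z \<subseteq> ground M" using Z by blast
  moreover have "(K0 \<union> Z) \<inter> Z = Z" by blast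
  ultimately have bC: "bases (contraction M Z) = {J. J \<subseteq> ground M - Z \<and> J \<union> Z \<in> bases M}"
    using bases_contraction[OF M C0, of Z] by simp
  have mC: "matroid (contraction M Z)" using matroid_contraction[OF M] .
  have K0C: "K0 \<in> bases (contraction M Z)" unfolding bC using C0 K0 S Z by blast
  have K0Y: "K0 - Y = K0" "K0 \<inter> Y = {}" using K0 by (auto simp: Y_def)
  have "\<forall>C\<in>bases (contraction M Z). card (C - Y) \<le> card (K0 - Y)"
  proof
    fix C assume C: "C \<in> bases (contraction M Z)"
    have "card (C - Y) \<le> card C" by (intro card_mono finite_basis[OF mC C]) blast
    then show "card (C - Y) \<le> card (K0 - Y)" using bases_equicardinal[OF mC C K0C] K0Y by simp
  qed
  note bN = bases_deletion[OF mC K0C this]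
  have gN: "ground N = S" using S Z by (auto simp: N_def Y_def)
  have card_basis: "card K = 2" if "K \<subseteq> S" "K \<union> Z \<in> bases M" for K
  proof -
    have "card (I \<union> Z) = card I + card Z" if "I \<subseteq> S" for I
      using that Z finite_subset[OF that finS] finite_subset[of Z "ground M"] finE
      by (intro card_Un_disjoint) auto
    from this[OF that(1)] this[OF K0(1)] show ?thesis using bases_equicardinal[OF M that(2) C0] K0 by linarith
  qed
  have diff: "ground M - Z - Y = S" using S Z unfolding Y_def by blast
  have "bases N = {K. K \<subseteq> S \<and> K \<subseteq> ground M - Z \<and> K \<union> Z \<in> bases M}"
    using bN unfolding K0Y N_def[symmetric] bC ground_contraction diff by simp
  also have "\<dots> = {K. K \<subseteq> S \<and> card K = 2}"
  proof (intro Collect_cong iffI)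
    show "K \<subseteq> S \<and> card K = 2" if "K \<subseteq> S \<and> K \<subseteq> ground M - Z \<and> K \<union> Z \<in> bases M" for K
      using that card_basis by simp
    show "K \<subseteq> S \<and> K \<subseteq> ground M - Z \<and> K \<union> Z \<in> bases M" if "K \<subseteq> S \<and> card K = 2" for K
      using that pairs S Z by blast
  qed
  finally have bN: "bases N = {K. K \<subseteq> S \<and> card K = 2}" .
  obtain f where f: "bij_betw f S {1..4::nat}"
    using finite_same_card_bij[OF finS, of "{1..4::nat}"] S by auto
  have inj: "inj_on f S" using f by (rule bij_betw_imp_inj_on)
  have "{C. C \<subseteq> {1..4} \<and> card C = 2} = (\<lambda>C. f ` C) ` {K. K \<subseteq> S \<and> card K = 2}"
  proof (intro set_eqI iffI)
    fix C :: "nat set" assume "C \<in> {C. C \<subseteq> {1..4} \<and> card C = 2}"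
    then have C: "C \<subseteq> f ` S" "card C = 2" using f unfolding bij_betw_def by auto
    then obtain K where K: "K \<subseteq> S" "C = f ` K" by (meson subset_imageE)
    then have "card K = 2" using C inj by (metis card_image inj_on_subset)
    then show "C \<in> (\<lambda>C. f ` C) ` {K. K \<subseteq> S \<and> card K = 2}" using K by blast
  next
    fix C assume "C \<in> (\<lambda>C. f ` C) ` {K. K \<subseteq> S \<and> card K = 2}"
    then obtain K where K: "K \<subseteq> S" "card K = 2" "C = f ` K" by blast
    then have "card C = 2" using inj by (metis card_image inj_on_subset)
    moreover have "C \<subseteq> {1..4}" using K f unfolding bij_betw_def by blast
    ultimately show "C \<in> {C. C \<subseteq> {1..4} \<and> card C = 2}" by blast
  qed
  then have "matroid_isomorphic N (uniform_matroid 2 4)"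
    unfolding matroid_isomorphic_def uniform_matroid_def using f by (auto simp: gN bN)
  moreover have "is_minor N M"
    unfolding is_minor_def N_def using Z by (intro exI[of _ Z] exI[of _ Y]) (auto simp: Y_def)
  ultimately show ?thesis by blast
qed

section \<open>Connectivity and separators\<close>

text \<open>
  The subset of the ground set that remains of a decomposition of \<open>M\<close> as a direct sum: along it, the
  parts of any two bases can be glued to a basis, and the two summands can be recovered from \<open>M\<close>.
\<close>

definition separator :: "'a basis_system \<Rightarrow> 'a set \<Rightarrow> bool" where
  "separator M S \<longleftrightarrow> S \<subseteq> ground M \<and>
     (\<forall>C\<in>bases M. \<forall>D\<in>bases M. (C \<inter> S) \<union> (D - S) \<in> bases M)"

lemma direct_sum_separator:
  assumes "M = direct_sum M1 M2" "matroid M1" "matroid M2" "ground M1 \<inter> ground M2 = {}"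
  shows "separator M (ground M1)"
proof -
  have "(C \<inter> ground M1) \<union> (D - ground M1) \<in> bases M" if CD: "C \<in> bases M" "D \<in> bases M" for C D
  proof -
    obtain C1 C2 D1 D2 where "C = C1 \<union> C2" "C1 \<in> bases M1" "C2 \<in> bases M2"
      "D = D1 \<union> D2" "D1 \<in> bases M1" "D2 \<in> bases M2"
      using CD unfolding assms(1) direct_sum_def by auto
    moreover from this have "C1 \<subseteq> ground M1" "D1 \<subseteq> ground M1" "C2 \<subseteq> ground M2" "D2 \<subseteq> ground M2"
      using basis_subset assms by blast+
    ultimately have "(C \<inter> ground M1) \<union> (D - ground M1) = C1 \<union> D2" using assms(4) by blast
    then show ?thesis using \<open>C1 \<in> bases M1\<close> \<open>D2 \<in> bases M2\<close> unfolding assms(1) direct_sum_def by auto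
  qed
  then show ?thesis unfolding separator_def assms(1) by (auto simp: direct_sum_def)
qed

lemma separator_compl:
  assumes M: "matroid M" and S: "separator M S"
  shows "separator M (ground M - S)"
proof -
  have "(C \<inter> (ground M - S)) \<union> (D - (ground M - S)) = (D \<inter> S) \<union> (C - S)"
    if "C \<in> bases M" "D \<in> bases M" for C D
    using that basis_subset[OF M] by blast
  then show ?thesis using S unfolding separator_def by auto
qed

lemma matroid_restrict_separator:
  assumes M: "matroid M" and S: "separator M S"
  shows "matroid \<lparr>ground = S, bases = (\<lambda>C. C \<inter> S) ` bases M\<rparr>"
proof -
  have "\<exists>y\<in>(D \<inter> S) - (C \<inter> S). insert y (C \<inter> S - {x}) \<in> (\<lambda>C. C \<inter> S) ` bases M"
    if C: "C \<in> bases M" and D: "D \<in> bases M" and x: "x \<in> (C \<inter> S) - (D \<inter> S)" for C D x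
  proof -
    have D': "(D \<inter> S) \<union> (C - S) \<in> bases M" using S C D unfolding separator_def by blast
    have "x \<in> C - ((D \<inter> S) \<union> (C - S))" using x by blast
    from basis_exchange[OF M C D' this] obtain y where
      y: "y \<in> ((D \<inter> S) \<union> (C - S)) - C" "insert y (C - {x}) \<in> bases M" by blast
    have "insert y (C \<inter> S - {x}) = insert y (C - {x}) \<inter> S" using y(1) by blast
    then show ?thesis using y by blast
  qed
  note exch = this
  have fin: "finite S"
    using finite_ground[OF M] S unfolding separator_def by (meson finite_subset)
  obtain C0 where C0: "C0 \<in> bases M" using ex_basis[OF M] by blast
  show ?thesis
    by (rule matroidI[where ?C0.0 = "C0 \<inter> S"]) (use fin C0 exch in auto)
qed

lemma connected_no_separator:
  fixes M :: "'a basis_system"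
  assumes M: "matroid M" and "connected_matroid M" and S: "separator M S"
  shows "S = {} \<or> S = ground M"
proof (rule ccontr)
  assume neg: "\<not> (S = {} \<or> S = ground M)"
  let ?R = "\<lambda>S. \<lparr>ground = S, bases = (\<lambda>C. C \<inter> S) ` bases M\<rparr>"
  let ?T = "ground M - S"
  have SM: "S \<subseteq> ground M" using S unfolding separator_def by blast
  have "bases M = {C \<union> D |C D. C \<in> (\<lambda>C. C \<inter> S) ` bases M \<and> D \<in> (\<lambda>C. C \<inter> ?T) ` bases M}"
  proof (intro set_eqI iffI)
    fix C assume C: "C \<in> bases M"
    then have "C = (C \<inter> S) \<union> (C \<inter> ?T)" using basis_subset[OF M] by blast
    then show "C \<in> {C \<union> D |C D. C \<in> (\<lambda>C. C \<inter> S) ` bases M \<and> D \<in> (\<lambda>C. C \<inter> ?T) ` bases M}"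
      using C by blast
  next
    fix C assume "C \<in> {C \<union> D |C D. C \<in> (\<lambda>C. C \<inter> S) ` bases M \<and> D \<in> (\<lambda>C. C \<inter> ?T) ` bases M}"
    then obtain C1 C2 where C: "C = (C1 \<inter> S) \<union> (C2 \<inter> ?T)" "C1 \<in> bases M" "C2 \<in> bases M" by blast
    have "C2 \<inter> ?T = C2 - S" using basis_subset[OF M C(3)] by blast
    then show "C \<in> bases M" using C S unfolding separator_def by auto
  qed
  then have "M = direct_sum (?R S) (?R ?T)"
    using SM unfolding direct_sum_def by (cases M) auto
  moreover have "matroid (?R S)" "matroid (?R ?T)"
    using matroid_restrict_separator[OF M] S separator_compl[OF M S] by auto
  ultimately show False using assms(2) neg SM unfolding connected_matroid_def
    by (metis (no_types, lifting) Diff_disjoint Diff_eq_empty_iff subset_antisym basis_system.select_convs(1))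
qed

lemma no_separator_connected:
  assumes M: "matroid M" and "\<And>S. separator M S \<Longrightarrow> S = {} \<or> S = ground M"
  shows "connected_matroid M"
  unfolding connected_matroid_def
proof
  assume "\<exists>M1 M2. matroid M1 \<and> matroid M2 \<and> ground M1 \<noteq> {} \<and> ground M2 \<noteq> {} \<and>
          ground M1 \<inter> ground M2 = {} \<and> M = direct_sum M1 M2"
  then obtain M1 M2 where *: "matroid M1" "matroid M2" "ground M1 \<noteq> {}" "ground M2 \<noteq> {}"
    "ground M1 \<inter> ground M2 = {}" "M = direct_sum M1 M2" by blast
  then have "ground M1 = ground M" using assms(2)[OF direct_sum_separator[OF *(6,1,2,5)]] by blast
  moreover have "ground M = ground M1 \<union> ground M2" using *(6) by (simp add: direct_sum_def)
  ultimately show False using * by blast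
qed

text \<open>
  Gluing the part of \<open>C\<close> inside \<open>S\<close> to the part of \<open>D\<close> outside \<open>S\<close> yields a basis,
  and all bases have the same size.  Hence a separator can be refuted by exhibiting two bases that meet
  it in different numbers of elements.
\<close>

lemma separator_card:
  assumes M: "matroid M" and S: "separator M S" and C: "C \<in> bases M" and D: "D \<in> bases M"
  shows "card (C \<inter> S) = card (D \<inter> S)"
proof -
  have B: "(C \<inter> S) \<union> (D - S) \<in> bases M" using assms unfolding separator_def by blast
  have fin: "finite C" "finite D" using finite_basis[OF M] C D by auto
  have "card ((C \<inter> S) \<union> (D - S)) = card (C \<inter> S) + card (D - S)"
    using fin by (intro card_Un_disjoint) auto
  moreover have "card D = card (D \<inter> S) + card (D - S)" using fin by (simp add: card_Int_Diff)
  ultimately show ?thesis using bases_equicardinal[OF M B D] by linarith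
qed

section \<open>Transport along isomorphisms\<close>

lemma matroid_isomorphic_sym:
  assumes "matroid_isomorphic M N" "\<And>C. C \<in> bases M \<Longrightarrow> C \<subseteq> ground M"
  shows "matroid_isomorphic N M"
proof -
  obtain f where f: "bij_betw f (ground M) (ground N)" "bases N = (\<lambda>C. f ` C) ` bases M"
    using assms unfolding matroid_isomorphic_def by blast
  let ?g = "inv_into (ground M) f"
  have "?g ` f ` C = C" if "C \<in> bases M" for C
    using f(1) assms(2)[OF that] by (simp add: bij_betw_def inv_into_image_cancel)
  then have "(\<lambda>C. ?g ` C) ` bases N = bases M" unfolding f(2) image_image by simp
  then show ?thesis unfolding matroid_isomorphic_def using bij_betw_inv_into[OF f(1)] by metis
qed

lemma u24_configuration_image:
  assumes g: "bij_betw g (ground L) (ground M)" and b: "bases M = (\<lambda>C. g ` C) ` bases L"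
    and SZ: "u24_configuration L S Z"
  shows "u24_configuration M (g ` S) (g ` Z)"
proof -
  have S: "S \<subseteq> ground L" "card S = 4" and Z: "Z \<subseteq> ground L - S"
    and pairs: "\<And>K. K \<subseteq> S \<Longrightarrow> card K = 2 \<Longrightarrow> K \<union> Z \<in> bases L"
    using SZ unfolding u24_configuration_def by auto
  have inj: "inj_on g (ground L)" and im: "g ` ground L = ground M"
    using g unfolding bij_betw_def by auto
  have injS: "inj_on g S" using inj S inj_on_subset by blast
  have "g ` Z \<subseteq> ground M - g ` S"
  proof -
    have "g ` Z \<subseteq> g ` (ground L - S)" using Z by blast
    also have "\<dots> = ground M - g ` S" using inj_on_image_set_diff[OF inj, of "ground L" S] S im by auto
    finally show ?thesis .
  qed
  moreover have "K \<union> g ` Z \<in> bases M" if K: "K \<subseteq> g ` S" "card K = 2" for K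
  proof -
    obtain K' where K': "K' \<subseteq> S" "K = g ` K'" using K by (meson subset_imageE)
    then have "card K' = 2" using K injS by (metis card_image inj_on_subset)
    from pairs[OF K'(1) this] show ?thesis unfolding b K'(2) image_Un[symmetric] by blast
  qed
  moreover have "g ` S \<subseteq> ground M" using S im by blast
  ultimately show ?thesis using S(2) injS unfolding u24_configuration_def
    by (simp add: card_image)
qed

lemma separator_image:
  assumes g: "bij_betw g (ground L) (ground M)" and b: "bases M = (\<lambda>C. g ` C) ` bases L"
    and sub: "\<And>C. C \<in> bases L \<Longrightarrow> C \<subseteq> ground L" and S: "separator L S"
  shows "separator M (g ` S)"
proof -
  have inj: "inj_on g (ground L)" and im: "g ` ground L = ground M"
    using g unfolding bij_betw_def by auto
  have SL: "S \<subseteq> ground L" using S unfolding separator_def by blast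
  have "(g ` C \<inter> g ` S) \<union> (g ` D - g ` S) = g ` ((C \<inter> S) \<union> (D - S))"
    if "C \<in> bases L" "D \<in> bases L" for C D
    using inj_on_image_Int[OF inj sub[OF that(1)] SL] inj_on_image_set_diff[OF inj _ SL, of D]
      sub[OF that(2)] by (simp add: image_Un subset_iff)
  moreover have "g ` S \<subseteq> ground M" using SL im by blast
  ultimately show ?thesis using S unfolding separator_def b by simp
qed

section \<open>Lattice path matroids as families of sets\<close>

text \<open>
  The height after \<open>k\<close> steps of the lattice path whose north steps are at the positions in \<open>C\<close>.
  Replacing words by their sets of north positions turns the bases into a family of sets that is
  cut out by bounds on these heights.
\<close>

definition cnt :: "nat set \<Rightarrow> nat \<Rightarrow> nat" where
  "cnt C k = card (C \<inter> {1..k})"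

lemma cnt_0 [simp]: "cnt C 0 = 0"
  by (simp add: cnt_def)

lemma cnt_Suc: "cnt C (Suc k) = cnt C k + of_bool (Suc k \<in> C)"
proof -
  have "C \<inter> {1..Suc k} = (if Suc k \<in> C then insert (Suc k) (C \<inter> {1..k}) else C \<inter> {1..k})"
    by (auto simp: le_Suc_eq)
  then show ?thesis by (simp add: cnt_def)
qed

lemma cnt_pred: "0 < k \<Longrightarrow> cnt C k = cnt C (k - 1) + of_bool (k \<in> C)"
  using cnt_Suc[of C "k - 1"] by simp

lemma cnt_eq_card: "C \<subseteq> {1..N} \<Longrightarrow> N \<le> k \<Longrightarrow> cnt C k = card C"
  unfolding cnt_def by (rule arg_cong[of _ _ card]) auto

lemma cnt_eqI: "(\<And>i. i \<in> {1..k} \<Longrightarrow> i \<in> C \<longleftrightarrow> i \<in> D) \<Longrightarrow> cnt C k = cnt D k"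
  unfolding cnt_def by (rule arg_cong[of _ _ card]) auto

lemma cnt_Un_disjoint: "C \<inter> D = {} \<Longrightarrow> cnt (C \<union> D) k = cnt C k + cnt D k"
  unfolding cnt_def by (subst card_Un_disjoint[symmetric]) (auto simp: Int_Un_distrib2)

lemma cnt_insert: "y \<notin> C \<Longrightarrow> 1 \<le> y \<Longrightarrow> cnt (insert y C) k = cnt C k + of_bool (y \<le> k)"
  by (induction k) (auto simp: cnt_Suc le_Suc_eq)

lemma cnt_empty [simp]: "cnt {} k = 0"
  by (simp add: cnt_def)

lemma cnt_exchange:
  assumes "x \<in> C" "y \<notin> C" "1 \<le> x" "1 \<le> y"
  shows "cnt (insert y (C - {x})) k + of_bool (x \<le> k) = cnt C k + of_bool (y \<le> k)"
proof -
  have "cnt (insert y (C - {x})) k = cnt (C - {x}) k + of_bool (y \<le> k)"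
    using assms by (intro cnt_insert) auto
  moreover have "cnt (insert x (C - {x})) k = cnt (C - {x}) k + of_bool (x \<le> k)"
    using assms by (intro cnt_insert) auto
  ultimately show ?thesis using assms(1) by (simp add: insert_absorb)
qed

text \<open>
  The lattice path matroid on \<open>N\<close> elements between the lower path \<open>L\<close> and the upper path \<open>U\<close>.
\<close>

definition path_matroid :: "nat \<Rightarrow> nat set \<Rightarrow> nat set \<Rightarrow> nat basis_system" where
  "path_matroid N L U = \<lparr>ground = {1..N},
     bases = {C. C \<subseteq> {1..N} \<and> (\<forall>k. cnt L k \<le> cnt C k \<and> cnt C k \<le> cnt U k)}\<rparr>"

lemma ground_path_matroid [simp]: "ground (path_matroid N L U) = {1..N}"
  by (simp add: path_matroid_def)

lemma bases_path_matroid: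
  "C \<in> bases (path_matroid N L U) \<longleftrightarrow>
     C \<subseteq> {1..N} \<and> (\<forall>k. cnt L k \<le> cnt C k \<and> cnt C k \<le> cnt U k)"
  by (simp add: path_matroid_def)

definition path_pair :: "nat \<Rightarrow> nat set \<Rightarrow> nat set \<Rightarrow> bool" where
  "path_pair N L U \<longleftrightarrow> L \<subseteq> {1..N} \<and> U \<subseteq> {1..N} \<and> card L = card U \<and> (\<forall>k. cnt L k \<le> cnt U k)"

text \<open>
  Compare the heights of two paths \<open>C\<close> and \<open>D\<close> around a north step \<open>x\<close> of \<open>C\<close> that is not one of \<open>D\<close>.
  If \<open>C\<close> is above \<open>D\<close> after this step, then \<open>C\<close> can be lowered from \<open>x\<close> up to the next point where
  the paths meet; otherwise \<open>C\<close> is below \<open>D\<close> before this step, and can be raised from the previous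
  meeting point up to \<open>x\<close>.  On the whole stretch where \<open>C\<close> moves, the path \<open>D\<close> leaves room for it.
\<close>

lemma matroid_path_matroid:
  assumes LU: "path_pair N L U"
  shows "matroid (path_matroid N L U)"
proof (rule matroidI)
  have L: "L \<subseteq> {1..N}" and U: "U \<subseteq> {1..N}" and crd: "card L = card U"
    and le: "\<And>k. cnt L k \<le> cnt U k"
    using LU unfolding path_pair_def by auto
  show "finite (ground (path_matroid N L U))" by simp
  show "L \<in> bases (path_matroid N L U)" using L le by (simp add: bases_path_matroid)
  show "C \<subseteq> ground (path_matroid N L U)" if "C \<in> bases (path_matroid N L U)" for C
    using that by (simp add: bases_path_matroid)
  fix C D x
  assume C: "C \<in> bases (path_matroid N L U)" and D: "D \<in> bases (path_matroid N L U)"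
    and x: "x \<in> C - D"
  have CN: "C \<subseteq> {1..N}" and Cb: "\<And>k. cnt L k \<le> cnt C k" "\<And>k. cnt C k \<le> cnt U k"
    using C by (auto simp: bases_path_matroid)
  have DN: "D \<subseteq> {1..N}" and Db: "\<And>k. cnt L k \<le> cnt D k" "\<And>k. cnt D k \<le> cnt U k"
    using D by (auto simp: bases_path_matroid)
  have x1: "1 \<le> x" "x \<le> N" using x CN by auto
  have endC: "cnt C N = cnt D N"
    using Cb[of N] Db[of N] crd cnt_eq_card[OF L, of N] cnt_eq_card[OF U, of N] by simp
  have stepx: "cnt C x = cnt C (x - 1) + 1" "cnt D x = cnt D (x - 1)"
    using cnt_pred[of x C] cnt_pred[of x D] x x1 by auto
  \<comment> \<open>The exchange lowers the path on \<open>[x, y)\<close> if \<open>x < y\<close>, and raises it on \<open>[y, x)\<close> otherwise.\<close>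
  have *: "\<exists>y\<in>D - C. insert y (C - {x}) \<in> bases (path_matroid N L U)"
    if y: "y \<in> D - C" and down: "\<And>k. x \<le> k \<Longrightarrow> k < y \<Longrightarrow> cnt L k < cnt C k"
      and up: "\<And>k. y \<le> k \<Longrightarrow> k < x \<Longrightarrow> cnt C k < cnt U k" for y
  proof -
    have y1: "1 \<le> y" "y \<le> N" using y DN by auto
    have "cnt L k \<le> cnt (insert y (C - {x})) k \<and> cnt (insert y (C - {x})) k \<le> cnt U k" for k
      using cnt_exchange[of x C y k] x y x1 y1 down[of k] up[of k] Cb[of k]
      by (cases "x \<le> k"; cases "y \<le> k") auto
    moreover have "insert y (C - {x}) \<subseteq> {1..N}" using CN y1 by auto
    ultimately show ?thesis using y by (auto simp: bases_path_matroid)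
  qed
  show "\<exists>y\<in>D - C. insert y (C - {x}) \<in> bases (path_matroid N L U)"
  proof (cases "cnt D x < cnt C x")
    case True
    define y where "y = (LEAST k. x < k \<and> cnt C k \<le> cnt D k)"
    have "x < N" using True endC x1 by (cases "x = N") auto
    then have y: "x < y" "cnt C y \<le> cnt D y"
      using LeastI[of "\<lambda>k. x < k \<and> cnt C k \<le> cnt D k" N] endC unfolding y_def by auto
    have before: "cnt D k < cnt C k" if "x \<le> k" "k < y" for k
      using not_less_Least[of k "\<lambda>k. x < k \<and> cnt C k \<le> cnt D k"] that True
      unfolding y_def[symmetric] by (cases "k = x") auto
    have "cnt D (y - 1) < cnt C (y - 1)" using before[of "y - 1"] y by simp
    then have "y \<in> D - C"
      using cnt_pred[of y C] cnt_pred[of y D] y by (cases "y \<in> C"; cases "y \<in> D") simp_all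
    moreover have "cnt L k < cnt C k" if "x \<le> k" "k < y" for k
      using before[OF that] Db[of k] by simp
    ultimately show ?thesis using y by (intro *) auto
  next
    case False
    then have less: "cnt C (x - 1) < cnt D (x - 1)" using stepx by simp
    define y where "y = (LEAST j. \<forall>k. j \<le> k \<and> k < x \<longrightarrow> cnt C k < cnt D k)"
    have init: "\<forall>k. x - 1 \<le> k \<and> k < x \<longrightarrow> cnt C k < cnt D k"
    proof (intro allI impI)
      fix k assume "x - 1 \<le> k \<and> k < x"
      then have "k = x - 1" by linarith
      then show "cnt C k < cnt D k" using less by simp
    qed
    have y: "\<And>k. y \<le> k \<Longrightarrow> k < x \<Longrightarrow> cnt C k < cnt D k"
      using LeastI[of "\<lambda>j. \<forall>k. j \<le> k \<and> k < x \<longrightarrow> cnt C k < cnt D k", OF init]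
      unfolding y_def[symmetric] by blast
    have yx: "y \<le> x - 1" unfolding y_def by (rule Least_le) (rule init)
    have y0: "y \<noteq> 0" using y[of 0] x1 by auto
    have "cnt D (y - 1) \<le> cnt C (y - 1)"
    proof (rule ccontr)
      assume "\<not> cnt D (y - 1) \<le> cnt C (y - 1)"
      then have "\<forall>k. y - 1 \<le> k \<and> k < x \<longrightarrow> cnt C k < cnt D k"
        using y by (metis Suc_diff_1 Suc_leI le_neq_implies_less not_le y0 bot_nat_0.not_eq_extremum)
      then have "y \<le> y - 1" unfolding y_def by (rule Least_le)
      then show False using y0 by simp
    qed
    then have "y \<in> D - C"
      using cnt_pred[of y C] cnt_pred[of y D] y0 y[OF order_refl, OF le_less_trans[OF yx]] x1
      by (cases "y \<in> C"; cases "y \<in> D") simp_all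
    moreover have "cnt C k < cnt U k" if "y \<le> k" "k < x" for k
      using y[OF that] Db(2)[of k] by simp
    ultimately show ?thesis using yx x1 by (intro *) auto
  qed
qed

lemma height_eq_cnt: "height w k = cnt (north_positions w) k"
proof (induction k)
  case 0
  show ?case by (simp add: height_def)
next
  case (Suc k)
  show ?case
  proof (cases "k < length w")
    case True
    then have "height w (Suc k) = height w k + of_bool (w ! k = North)"
      by (simp add: height_def take_Suc_conv_app_nth)
    then show ?thesis using Suc True by (simp add: cnt_Suc north_positions_def)
  next
    case False
    then have "height w (Suc k) = height w k" by (simp add: height_def)
    then show ?thesis using Suc False by (simp add: cnt_Suc north_positions_def)
  qed
qed

lemma north_positions_subset: "north_positions w \<subseteq> {1..length w}"
  by (auto simp: north_positions_def)

lemma card_north_positions: "card (north_positions w) = count_list w North"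
  using height_eq_cnt[of w "length w"] cnt_eq_card[OF north_positions_subset, of w "length w"]
  by (simp add: height_def)

lemma count_East_North: "count_list w East + count_list w North = length w"
proof (induction w)
  case (Cons s w)
  then show ?case by (cases s) auto
qed simp

lemma lattice_path_iff:
  "lattice_path m r w \<longleftrightarrow> length w = m + r \<and> card (north_positions w) = r"
  using count_East_North[of w] unfolding lattice_path_def card_north_positions by auto

lemma never_above_iff:
  "never_above v w \<longleftrightarrow> (\<forall>k. cnt (north_positions v) k \<le> cnt (north_positions w) k)"
  by (simp add: never_above_def height_eq_cnt)

lemma ex_word_north_positions:
  assumes "C \<subseteq> {1..N}"
  shows "\<exists>w. length w = N \<and> north_positions w = C"
proof -
  let ?w = "map (\<lambda>i. if Suc i \<in> C then North else East) [0..<N]"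
  have "i \<in> north_positions ?w \<longleftrightarrow> i \<in> C" for i
  proof (cases "i \<in> {1..N}")
    case True
    then obtain j where "i = Suc j" "j < N" by (cases i) auto
    then show ?thesis by (simp add: north_positions_def)
  next
    case False
    then show ?thesis using assms by (auto simp: north_positions_def)
  qed
  then show ?thesis by (intro exI[of _ ?w]) auto
qed

lemma lattice_path_matroid_iff:
  "lattice_path_matroid L \<longleftrightarrow> (\<exists>N S U. path_pair N S U \<and> L = path_matroid N S U)"
proof -
  have eq: "lattice_path_matroid_of m r P Q = path_matroid (m + r) (north_positions P) (north_positions Q)"
    if P: "lattice_path m r P" and Q: "lattice_path m r Q" for m r P Q
  proof -
    have "C \<in> bases (lattice_path_matroid_of m r P Q) \<longleftrightarrow>
        C \<in> bases (path_matroid (m + r) (north_positions P) (north_positions Q))" for C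
    proof
      assume "C \<in> bases (lattice_path_matroid_of m r P Q)"
      then obtain w where w: "C = north_positions w" "lattice_path m r w" "never_above P w" "never_above w Q"
        unfolding lattice_path_matroid_of_def by auto
      have "C \<subseteq> {1..m + r}"
        using w(2) north_positions_subset[of w] unfolding w(1) lattice_path_iff by simp
      then show "C \<in> bases (path_matroid (m + r) (north_positions P) (north_positions Q))"
        using w(3,4) unfolding w(1) by (simp add: bases_path_matroid never_above_iff)
    next
      assume C: "C \<in> bases (path_matroid (m + r) (north_positions P) (north_positions Q))"
      then have sub: "C \<subseteq> {1..m + r}" by (simp add: bases_path_matroid)
      obtain w where w: "length w = m + r" "north_positions w = C"
        using ex_word_north_positions[OF sub] by blast
      have "cnt (north_positions P) (m + r) = r" "cnt (north_positions Q) (m + r) = r"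
        using P Q north_positions_subset[of P] north_positions_subset[of Q]
        by (auto simp: lattice_path_iff cnt_eq_card[of _ "m + r"])
      then have "card C = r"
        using C cnt_eq_card[OF sub order_refl] by (simp add: bases_path_matroid) (metis le_antisym)
      then have "lattice_path m r w" using w by (simp add: lattice_path_iff)
      moreover have "never_above P w" "never_above w Q"
        using C w(2) by (auto simp: never_above_iff bases_path_matroid)
      ultimately show "C \<in> bases (lattice_path_matroid_of m r P Q)"
        unfolding lattice_path_matroid_of_def using w(2) by auto
    qed
    then have "bases (lattice_path_matroid_of m r P Q) =
        bases (path_matroid (m + r) (north_positions P) (north_positions Q))" by blast
    then show ?thesis by (simp add: lattice_path_matroid_of_def path_matroid_def)
  qed
  show ?thesis
  proof
    assume "lattice_path_matroid L"
    then obtain m r P Q where *: "lattice_path m r P" "lattice_path m r Q" "never_above P Q"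
      "L = lattice_path_matroid_of m r P Q" unfolding lattice_path_matroid_def by blast
    have "path_pair (m + r) (north_positions P) (north_positions Q)"
      using * north_positions_subset[of P] north_positions_subset[of Q]
      unfolding path_pair_def by (simp add: lattice_path_iff never_above_iff)
    then show "\<exists>N S U. path_pair N S U \<and> L = path_matroid N S U"
      using eq[OF *(1,2)] *(4) by blast
  next
    assume "\<exists>N S U. path_pair N S U \<and> L = path_matroid N S U"
    then obtain N S U where *: "path_pair N S U" "L = path_matroid N S U" by blast
    have S: "S \<subseteq> {1..N}" and U: "U \<subseteq> {1..N}" using *(1) by (auto simp: path_pair_def)
    obtain P where P: "length P = N" "north_positions P = S" using ex_word_north_positions[OF S] by blast
    obtain Q where Q: "length Q = N" "north_positions Q = U" using ex_word_north_positions[OF U] by blast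
    have "card S \<le> N" using card_mono[OF _ S] by simp
    then have lp: "lattice_path (N - card S) (card S) P" "lattice_path (N - card S) (card S) Q"
      using P Q *(1) by (auto simp: lattice_path_iff path_pair_def)
    have "never_above P Q" using *(1) P Q by (simp add: never_above_iff path_pair_def)
    moreover have "L = lattice_path_matroid_of (N - card S) (card S) P Q"
      using eq[OF lp] P(2) Q(2) \<open>card S \<le> N\<close> *(2) by simp
    ultimately show "lattice_path_matroid L"
      unfolding lattice_path_matroid_def using lp by blast
  qed
qed

section \<open>Snake matroids are the lattice path matroids of width one\<close>

text \<open>
  If the two boundary paths touch after \<open>k\<close> steps, then all paths pass through that point, and the
  initial part of one path can be continued by the final part of another.
\<close>

lemma path_matroid_separator:
  assumes k: "k \<le> N" and eq: "cnt L k = cnt U k"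
  shows "separator (path_matroid N L U) {1..k}"
  unfolding separator_def
proof (intro conjI ballI)
  show "{1..k} \<subseteq> ground (path_matroid N L U)" using k by auto
  fix C D assume C: "C \<in> bases (path_matroid N L U)" and D: "D \<in> bases (path_matroid N L U)"
  let ?M = "(C \<inter> {1..k}) \<union> (D - {1..k})"
  have Ck: "cnt C k = cnt D k" using C D eq unfolding bases_path_matroid by (metis le_antisym)
  have low: "cnt ?M j = cnt C j" if "j \<le> k" for j
    using that by (intro cnt_eqI) auto
  have high: "cnt ?M j = cnt D j" if "k \<le> j" for j
    using that
  proof (induction j rule: dec_induct)
    case base
    show ?case using low[of k] Ck by simp
  next
    case (step j)
    then show ?case by (simp add: cnt_Suc)
  qed
  have "cnt L j \<le> cnt ?M j \<and> cnt ?M j \<le> cnt U j" for j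
    using low[of j] high[of j] C D unfolding bases_path_matroid by (cases "j \<le> k") auto
  then show "?M \<in> bases (path_matroid N L U)"
    using C D unfolding bases_path_matroid by blast
qed

text \<open>
  Let \<open>s < t\<close> be the two smallest of the four elements.  After \<open>t\<close> steps, the path that takes both of
  them is two higher than the path that takes the other two, whereas the boundary paths are
  at distance at most one.
\<close>

lemma path_matroid_no_u24:
  assumes gap: "\<And>k. cnt U k \<le> cnt L k + 1"
  shows "\<not> u24_configuration (path_matroid N L U) S Z"
proof
  assume "u24_configuration (path_matroid N L U) S Z"
  then have S: "S \<subseteq> {1..N}" "card S = 4" and Z: "Z \<inter> S = {}"
    and pairs: "\<And>K. K \<subseteq> S \<Longrightarrow> card K = 2 \<Longrightarrow> K \<union> Z \<in> bases (path_matroid N L U)"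
    unfolding u24_configuration_def by auto
  have fin: "finite S" and ne: "S \<noteq> {}" using S by (auto intro: finite_subset)
  define s where "s = Min S"
  define S' where "S' = S - {s}"
  define t where "t = Min S'"
  have s: "s \<in> S" "\<And>x. x \<in> S \<Longrightarrow> s \<le> x"
    using Min_in[OF fin ne] Min_le[OF fin] unfolding s_def by auto
  have S': "card S' = 3" "finite S'" using s S fin unfolding S'_def by auto
  then have ne': "S' \<noteq> {}" by auto
  have t: "t \<in> S'" "\<And>x. x \<in> S' \<Longrightarrow> t \<le> x"
    using Min_in[OF S'(2) ne'] Min_le[OF S'(2)] unfolding t_def by auto
  define K where "K = S' - {t}"
  have K: "K \<subseteq> S" "card K = 2" using t S' unfolding K_def S'_def by auto
  have st: "{s, t} \<subseteq> S" "s \<noteq> t" "1 \<le> s" "1 \<le> t" "s \<le> t" using s t S unfolding S'_def by auto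
  have "cnt K t = 0"
  proof -
    have "t < i" if "i \<in> K" for i
      using that t(2)[of i] unfolding K_def by (simp add: le_less)
    then have "K \<inter> {1..t} = {}" by fastforce
    then show ?thesis unfolding cnt_def by simp
  qed
  moreover have "cnt {s, t} t = 2"
    using st cnt_insert[of s "{t}" t] cnt_insert[of t "{}" t] by simp
  moreover have "cnt (K \<union> Z) t = cnt K t + cnt Z t" "cnt ({s, t} \<union> Z) t = cnt {s, t} t + cnt Z t"
    using K(1) st(1) Z by (intro cnt_Un_disjoint; blast)+
  moreover have "cnt L t \<le> cnt (K \<union> Z) t" using pairs[OF K] by (simp add: bases_path_matroid)
  moreover have "cnt ({s, t} \<union> Z) t \<le> cnt U t"
    using pairs[OF st(1)] st(2) unfolding bases_path_matroid by simp
  ultimately show False using gap[of t] by linarith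
qed

text \<open>
  Let the distance of the boundary paths become two at step \<open>u\<close>, and drop below two at the step \<open>v\<close>
  that follows.  Together with the first and last positions, \<open>u\<close> and \<open>v\<close> form the required set of four
  elements: the lower path is north at \<open>v\<close> and \<open>N\<close>, and moving its two north steps from there to
  \<open>1\<close> and \<open>u\<close> raises it by one on \<open>[1, N)\<close> and by one more on \<open>[u, v)\<close>,
  which is what the upper path allows.  The paths of the other four pairs lie between these two.
\<close>

lemma path_matroid_u24:
  assumes LU: "path_pair N L U" and strict: "\<And>k. 0 < k \<Longrightarrow> k < N \<Longrightarrow> cnt L k < cnt U k"
    and gap: "cnt L k0 + 2 \<le> cnt U k0"
  shows "\<exists>S Z. u24_configuration (path_matroid N L U) S Z"
proof -
  have L: "L \<subseteq> {1..N}" and U: "U \<subseteq> {1..N}" and crd: "card L = card U"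
    and le: "\<And>k. cnt L k \<le> cnt U k"
    using LU unfolding path_pair_def by auto
  have ends: "cnt L k = cnt U k" if "N \<le> k" for k
    using cnt_eq_card[OF L that] cnt_eq_card[OF U that] crd by simp
  have k0: "k0 < N" using gap ends[of k0] by (cases "k0 < N") auto
  define u where "u = (LEAST k. cnt L k + 2 \<le> cnt U k)"
  have u: "cnt L u + 2 \<le> cnt U u" "u \<le> k0"
    using LeastI[of "\<lambda>k. cnt L k + 2 \<le> cnt U k", OF gap] Least_le[of "\<lambda>k. cnt L k + 2 \<le> cnt U k", OF gap]
    unfolding u_def by auto
  have u0: "u \<noteq> 0" using u by (cases u) auto
  then have u_pred: "cnt U (u - 1) \<le> cnt L (u - 1) + 1"
    using not_less_Least[of "u - 1" "\<lambda>k. cnt L k + 2 \<le> cnt U k"] unfolding u_def[symmetric] by simp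
  have u1: "u \<noteq> 1" using u(1) cnt_pred[of 1 U] by (auto simp: of_bool_def split: if_splits)
  have uL: "u \<notin> L" using u u_pred u0 cnt_pred[of u L] cnt_pred[of u U] by (auto simp: of_bool_def split: if_splits)
  define v where "v = (LEAST k. u \<le> k \<and> cnt U k \<le> cnt L k + 1)"
  have vex: "u \<le> N \<and> cnt U N \<le> cnt L N + 1" using ends[of N] u(2) k0 by simp
  have v: "u \<le> v" "cnt U v \<le> cnt L v + 1" "v \<le> N"
    using LeastI[of "\<lambda>k. u \<le> k \<and> cnt U k \<le> cnt L k + 1", OF vex]
      Least_le[of "\<lambda>k. u \<le> k \<and> cnt U k \<le> cnt L k + 1", OF vex] unfolding v_def by auto
  have uv: "u < v" using v u by (cases "u = v") auto
  have mid: "cnt L k + 2 \<le> cnt U k" if "u \<le> k" "k < v" for k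
    using not_less_Least[of k "\<lambda>k. u \<le> k \<and> cnt U k \<le> cnt L k + 1"] that unfolding v_def[symmetric] by auto
  have v_pred: "cnt L (v - 1) + 2 \<le> cnt U (v - 1)" using mid[of "v - 1"] uv by simp
  have vL: "v \<in> L" using v v_pred uv cnt_pred[of v L] cnt_pred[of v U] by (auto simp: of_bool_def split: if_splits)
  have vN: "v < N"
    using v v_pred uv cnt_pred[of v L] cnt_pred[of v U] ends[of N]
    by (cases "v = N") (auto simp: of_bool_def split: if_splits)
  have N2: "1 < N" using uv vN u0 by simp
  have L1: "1 \<notin> L" using strict[of 1] N2 cnt_pred[of 1 L] cnt_pred[of 1 U] by (auto simp: of_bool_def split: if_splits)
  have LN: "N \<in> L"
    using strict[of "N - 1"] N2 cnt_pred[of N L] cnt_pred[of N U] ends[of N]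
    by (auto simp: of_bool_def split: if_splits)
  let ?S = "{1, u, v, N}" and ?Z = "L - {v, N}"
  have order: "1 < u" "u < v" "v < N" using u0 u1 uv vN by auto
  have cntL: "cnt L k = cnt ?Z k + of_bool (v \<le> k) + of_bool (N \<le> k)" for k
  proof -
    have "L = insert v (insert N ?Z)" using vL LN by blast
    then have "cnt L k = cnt (insert v (insert N ?Z)) k" by simp
    also have "\<dots> = cnt (insert N ?Z) k + of_bool (v \<le> k)" using order by (intro cnt_insert) auto
    also have "cnt (insert N ?Z) k = cnt ?Z k + of_bool (N \<le> k)" using order by (intro cnt_insert) auto
    finally show ?thesis by simp
  qed
  have cntU: "cnt ?Z k + of_bool (1 \<le> k) + of_bool (u \<le> k) \<le> cnt U k" for k
  proof -
    have "cnt L k + of_bool (1 \<le> k \<and> k < N) + of_bool (u \<le> k \<and> k < v) \<le> cnt U k"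
      using strict[of k] mid[of k] le[of k] by auto
    then show ?thesis using cntL[of k] order by (auto simp: of_bool_def split: if_splits)
  qed
  have "K \<union> ?Z \<in> bases (path_matroid N L U)" if K: "K \<subseteq> ?S" "card K = 2" for K
  proof -
    obtain x y where xy: "K = {x, y}" "x \<noteq> y" using K(2) by (auto simp: card_2_iff)
    have mem: "x \<in> ?S" "y \<in> ?S" using K(1) xy by auto
    have pos: "1 \<le> x" "1 \<le> y" "x \<le> N" "y \<le> N" using mem order by auto
    have "K \<inter> ?Z = {}" using K(1) L1 uL by auto
    then have KZ: "cnt (K \<union> ?Z) k = of_bool (x \<le> k) + of_bool (y \<le> k) + cnt ?Z k" for k
      using cnt_Un_disjoint[of K ?Z k] cnt_insert[of x "{y}" k] cnt_insert[of y "{}" k] xy pos by simp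
    have "cnt L k \<le> cnt (K \<union> ?Z) k \<and> cnt (K \<union> ?Z) k \<le> cnt U k" for k
      using cntL[of k] cntU[of k] KZ[of k] mem xy(2) order
      by (auto simp: of_bool_def split: if_splits)
    moreover have "K \<union> ?Z \<subseteq> {1..N}" using L xy pos by auto
    ultimately show ?thesis by (simp add: bases_path_matroid)
  qed
  moreover have "?S \<subseteq> {1..N}" "card ?S = 4" using order by auto
  moreover have "?Z \<subseteq> {1..N} - ?S" using L L1 uL by auto
  ultimately have "u24_configuration (path_matroid N L U) ?S ?Z"
    unfolding u24_configuration_def ground_path_matroid by blast
  then show ?thesis by blast
qed


text \<open>
  The paths between the lower path \<open>T\<close> and the path that runs one unit above it strictly between the
  two endpoints.
\<close>

definition snake_path_matroid :: "nat \<Rightarrow> nat set \<Rightarrow> nat basis_system" where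
  "snake_path_matroid N T = \<lparr>ground = {1..N},
     bases = {C. C \<subseteq> {1..N} \<and>
       (\<forall>k. cnt T k \<le> cnt C k \<and> cnt C k \<le> cnt T k + of_bool (1 \<le> k \<and> k < N))}\<rparr>"

lemma ground_snake_path_matroid [simp]: "ground (snake_path_matroid N T) = {1..N}"
  by (simp add: snake_path_matroid_def)

lemma bases_snake_path_matroid:
  "C \<in> bases (snake_path_matroid N T) \<longleftrightarrow> C \<subseteq> {1..N} \<and>
     (\<forall>k. cnt T k \<le> cnt C k \<and> cnt C k \<le> cnt T k + of_bool (1 \<le> k \<and> k < N))"
  by (simp add: snake_path_matroid_def)

text \<open>
  The paths that begin with an east step and end with a north step; only these can be raised by one
  unit strictly between their endpoints.
\<close>

definition snake_word :: "nat \<Rightarrow> nat set \<Rightarrow> bool" where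
  "snake_word N T \<longleftrightarrow> T \<subseteq> {1..N} \<and> 1 \<notin> T \<and> N \<in> T"

text \<open>
  Moving the last north step of \<open>T\<close> to the first position raises the path by one everywhere except at
  its endpoints.
\<close>

lemma snake_path_matroid_eq:
  assumes T: "snake_word N T"
  defines "U \<equiv> insert 1 (T - {N})"
  shows "path_pair N T U" "snake_path_matroid N T = path_matroid N T U"
    "cnt U k = cnt T k + of_bool (1 \<le> k \<and> k < N)"
proof -
  have T': "T \<subseteq> {1..N}" "1 \<notin> T" "N \<in> T" and N: "1 < N"
    using T unfolding snake_word_def by (auto simp: le_less)
  have U: "U \<subseteq> {1..N}" using T' N unfolding U_def by auto
  have "finite T" using T'(1) finite_subset by blast
  then have crd: "card T = card U" unfolding U_def using T' by (intro card_exchange[symmetric])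
  show cU: "cnt U k = cnt T k + of_bool (1 \<le> k \<and> k < N)" for k
    using cnt_exchange[of N T 1 k] T' N unfolding U_def by (auto simp: of_bool_def split: if_splits)
  show "path_pair N T U" unfolding path_pair_def using T' U crd cU by simp
  show "snake_path_matroid N T = path_matroid N T U"
    unfolding snake_path_matroid_def path_matroid_def cU ..
qed

lemma card_exchange_Int:
  assumes "finite C" "x \<in> C" "y \<notin> C" "card (insert y (C - {x}) \<inter> S) = card (C \<inter> S)"
  shows "x \<in> S \<longleftrightarrow> y \<in> S"
proof -
  have fin: "finite (C \<inter> S)" using assms(1) by blast
  have *: "insert y (C - {x}) \<inter> S = (if y \<in> S then insert y (C \<inter> S - {x}) else C \<inter> S - {x})"
    by auto
  have "card (C \<inter> S - {x}) = (if x \<in> S then card (C \<inter> S) - 1 else card (C \<inter> S))"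
    using assms(2) fin by auto
  moreover have "x \<in> S \<Longrightarrow> 0 < card (C \<inter> S)" using assms(2) fin by (auto simp: card_gt_0_iff)
  ultimately show ?thesis using assms(3,4) fin unfolding * by (auto split: if_splits)
qed

text \<open>
  Connectedness: the path may leave the upper boundary for the lower one at any north step \<open>k\<close> of
  \<open>T\<close>, which replaces \<open>k\<close> by \<open>1\<close> in \<open>T\<close>; and it may leave the lower boundary
  for the upper one at any east step \<open>k\<close>, which replaces \<open>N\<close> by \<open>k\<close>.  Since a separator meets
  all bases in the same number of elements, it contains either all or none of the positions.
\<close>

lemma snake_matroid_snake_path_matroid:
  assumes T: "snake_word N T"
  shows "snake_matroid (snake_path_matroid N T)"
proof -
  let ?M = "snake_path_matroid N T"
  have T': "T \<subseteq> {1..N}" "1 \<notin> T" "N \<in> T" and N: "1 < N"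
    using T unfolding snake_word_def by (auto simp: le_less)
  have finT: "finite T" using T'(1) finite_subset by blast
  note eq = snake_path_matroid_eq[OF T]
  have M: "matroid ?M" unfolding eq(2) by (rule matroid_path_matroid[OF eq(1)])
  have "S = {} \<or> S = ground ?M" if S: "separator ?M S" for S
  proof -
    have TB: "T \<in> bases ?M" using T'(1) by (simp add: bases_snake_path_matroid)
    have north: "k \<in> S \<longleftrightarrow> 1 \<in> S" if k: "k \<in> T" for k
    proof -
      have k1: "1 \<le> k" "k \<le> N" using k T'(1) by auto
      have "cnt T j \<le> cnt (insert 1 (T - {k})) j \<and>
          cnt (insert 1 (T - {k})) j \<le> cnt T j + of_bool (1 \<le> j \<and> j < N)" for j
        using cnt_exchange[of k T 1 j] k T'(2) k1 by (auto simp: of_bool_def split: if_splits)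
      moreover have "insert 1 (T - {k}) \<subseteq> {1..N}" using T'(1) N by auto
      ultimately have "insert 1 (T - {k}) \<in> bases ?M" unfolding bases_snake_path_matroid by blast
      then show ?thesis
        using separator_card[OF M S _ TB] k T'(2) by (intro card_exchange_Int[OF finT]) auto
    qed
    have east: "N \<in> S \<longleftrightarrow> k \<in> S" if k: "k \<notin> T" "k \<in> {1..N}" for k
    proof -
      have "cnt T j \<le> cnt (insert k (T - {N})) j \<and>
          cnt (insert k (T - {N})) j \<le> cnt T j + of_bool (1 \<le> j \<and> j < N)" for j
        using cnt_exchange[of N T k j] k T'(3) N by (auto simp: of_bool_def split: if_splits)
      moreover have "insert k (T - {N}) \<subseteq> {1..N}" using T'(1) k by auto
      ultimately have "insert k (T - {N}) \<in> bases ?M" unfolding bases_snake_path_matroid by blast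
      then show ?thesis
        using separator_card[OF M S _ TB] k T'(3) by (intro card_exchange_Int[OF finT]) auto
    qed
    have "k \<in> S \<longleftrightarrow> 1 \<in> S" if "k \<in> {1..N}" for k
      using north east[OF _ that] T'(3) by (cases "k \<in> T") auto
    moreover have "S \<subseteq> {1..N}" using S unfolding separator_def by simp
    ultimately show ?thesis unfolding ground_snake_path_matroid by blast
  qed
  then have "connected_matroid ?M" by (rule no_separator_connected[OF M])
  moreover have "lattice_path_matroid ?M" unfolding lattice_path_matroid_iff using eq by blast
  moreover have "matroid_isomorphic ?M ?M"
    unfolding matroid_isomorphic_def by (intro exI[of _ id]) auto
  moreover have "\<not> u24_configuration ?M S Z" for S Z
    unfolding eq(2) by (rule path_matroid_no_u24) (simp add: eq(3)[unfolded One_nat_def])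
  then have "\<not> (\<exists>K. is_minor K ?M \<and> matroid_isomorphic K (uniform_matroid 2 4))"
    using u24_minor_imp_configuration[OF M] by blast
  ultimately show ?thesis using M N unfolding snake_matroid_def by auto
qed

text \<open>
  Connectedness forces the two boundary paths apart strictly between their endpoints, and the
  absence of \<open>U(2,4)\<close> keeps their distance at most one.
\<close>

lemma snake_matroid_imp_snake_path_matroid:
  assumes gM: "ground M = {1..N::nat}" and snake: "snake_matroid M"
  obtains T g where "snake_word N T" "bij_betw g {1..N} {1..N}"
    "bases M = (\<lambda>C. g ` C) ` bases (snake_path_matroid N T)"
proof -
  have M: "matroid M" and N: "1 < N" and conn: "connected_matroid M"
    and no: "\<not> (\<exists>K. is_minor K M \<and> matroid_isomorphic K (uniform_matroid 2 4))"
    and "\<exists>L. lattice_path_matroid L \<and> matroid_isomorphic M L"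
    using snake gM unfolding snake_matroid_def by auto
  then obtain N' L U where LU': "path_pair N' L U" and iso: "matroid_isomorphic M (path_matroid N' L U)"
    unfolding lattice_path_matroid_iff by blast
  have "card {1..N} = card {1..N'}"
    using iso gM unfolding matroid_isomorphic_def by (auto dest: bij_betw_same_card)
  then have "N' = N" by simp
  note LU = LU'[unfolded this] and iso = iso[unfolded this]
  let ?L = "path_matroid N L U"
  have mL: "matroid ?L" by (rule matroid_path_matroid[OF LU])
  obtain g where g: "bij_betw g (ground ?L) (ground M)" and b: "bases M = (\<lambda>C. g ` C) ` bases ?L"
    using matroid_isomorphic_sym[OF iso basis_subset[OF M]] unfolding matroid_isomorphic_def by blast
  have L: "L \<subseteq> {1..N}" and U: "U \<subseteq> {1..N}" and crd: "card L = card U"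
    and le: "\<And>k. cnt L k \<le> cnt U k"
    using LU unfolding path_pair_def by auto
  have ends: "cnt L k = cnt U k" if "N \<le> k" for k
    using cnt_eq_card[OF L that] cnt_eq_card[OF U that] crd by simp
  have strict: "cnt L k < cnt U k" if k: "0 < k" "k < N" for k
  proof (rule ccontr)
    assume "\<not> cnt L k < cnt U k"
    then have "cnt L k = cnt U k" using le[of k] by simp
    then have "separator ?L {1..k}" using k by (intro path_matroid_separator) auto
    then have "separator M (g ` {1..k})"
      using separator_image[OF g b] basis_subset[OF mL] by blast
    from connected_no_separator[OF M conn this]
    have "g ` {1..k} = {} \<or> g ` {1..k} = {1..N}" unfolding gM .
    then have "card (g ` {1..k}) = 0 \<or> card (g ` {1..k}) = N" by (elim disjE) simp_all
    moreover have "inj_on g {1..k}"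
      by (rule inj_on_subset[OF bij_betw_imp_inj_on[OF g]]) (use k in auto)
    then have "card (g ` {1..k}) = k" by (simp add: card_image)
    ultimately show False using k by simp
  qed
  have gap: "cnt U k \<le> cnt L k + 1" for k
  proof (rule ccontr)
    assume "\<not> cnt U k \<le> cnt L k + 1"
    then have "\<exists>S Z. u24_configuration ?L S Z"
      by (intro path_matroid_u24[OF LU strict, of k]) auto
    then show False
      using u24_configuration_image[OF g b] u24_configuration_imp_minor[OF M] no by blast
  qed
  have cU: "cnt U k = cnt L k + of_bool (1 \<le> k \<and> k < N)" for k
    using strict[of k] gap[of k] ends[of k] by (cases "k = 0"; cases "k < N") auto
  have "1 \<notin> L" using cU[of 1] N cnt_pred[of 1 L] cnt_pred[of 1 U]
    by (auto simp: of_bool_def split: if_splits)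
  moreover have "N \<in> L"
    using cU[of "N - 1"] cU[of N] N cnt_pred[of N L] cnt_pred[of N U]
    by (auto simp: of_bool_def split: if_splits)
  ultimately have "snake_word N L" using L unfolding snake_word_def by blast
  moreover have "?L = snake_path_matroid N L"
    unfolding snake_path_matroid_def path_matroid_def cU ..
  ultimately show thesis using that[of L g] g b gM by simp
qed

section \<open>Coordinate maps and integral equivalence\<close>

abbreviation lookup :: "vec_fin \<Rightarrow> nat \<Rightarrow> real" where
  "lookup \<equiv> Poly_Mapping.lookup"

abbreviation indicator_vec :: "nat set \<Rightarrow> vec_fin" where
  "indicator_vec C \<equiv> \<Sum>i\<in>C. Poly_Mapping.single i 1"

lemma lookup_scaleR_vec: "lookup (r *\<^sub>R x) k = r * lookup x k"
proof -
  have "finite {i. lookup x i \<noteq> 0}" by simp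
  then have "finite {i. r * lookup x i \<noteq> 0}" by (rule rev_finite_subset) auto
  then show ?thesis by (simp add: scaleR_poly_mapping_def Abs_poly_mapping_inverse)
qed

lemma lookup_sum_single:
  assumes "finite I" "inj_on \<sigma> I"
  shows "i \<in> I \<Longrightarrow> lookup (\<Sum>i\<in>I. Poly_Mapping.single (\<sigma> i) (h i)) (\<sigma> i) = h i"
    and "k \<notin> \<sigma> ` I \<Longrightarrow> lookup (\<Sum>i\<in>I. Poly_Mapping.single (\<sigma> i) (h i)) k = 0"
proof -
  assume i: "i \<in> I"
  have "lookup (\<Sum>i\<in>I. Poly_Mapping.single (\<sigma> i) (h i)) (\<sigma> i) = (\<Sum>j\<in>I. if j = i then h j else 0)"
    unfolding lookup_sum using assms(2) i
    by (intro sum.cong) (auto simp: lookup_single when_def inj_on_eq_iff)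
  also have "\<dots> = h i" using i assms(1) by simp
  finally show "lookup (\<Sum>i\<in>I. Poly_Mapping.single (\<sigma> i) (h i)) (\<sigma> i) = h i" .
next
  assume "k \<notin> \<sigma> ` I"
  then show "lookup (\<Sum>i\<in>I. Poly_Mapping.single (\<sigma> i) (h i)) k = 0"
    unfolding lookup_sum by (intro sum.neutral) (auto simp: lookup_single when_def)
qed

lemma lookup_indicator_vec: "finite C \<Longrightarrow> lookup (indicator_vec C) k = of_bool (k \<in> C)"
  using lookup_sum_single[of C "\<lambda>i. i" k "\<lambda>_. 1"] by (cases "k \<in> C") simp_all

text \<open>
  The affine map that renames the coordinates in \<open>I\<close> by \<open>\<sigma>\<close> after a translation by \<open>c\<close>.
\<close>

definition coord_map :: "nat set \<Rightarrow> (nat \<Rightarrow> nat) \<Rightarrow> (nat \<Rightarrow> real) \<Rightarrow> vec_fin \<Rightarrow> vec_fin" where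
  "coord_map I \<sigma> c x = (\<Sum>i\<in>I. Poly_Mapping.single (\<sigma> i) (lookup x i + c i))"

lemma lookup_coord_map:
  assumes "finite I" "inj_on \<sigma> I"
  shows "i \<in> I \<Longrightarrow> lookup (coord_map I \<sigma> c x) (\<sigma> i) = lookup x i + c i"
    and "k \<notin> \<sigma> ` I \<Longrightarrow> lookup (coord_map I \<sigma> c x) k = 0"
  unfolding coord_map_def by (rule lookup_sum_single[OF assms]; assumption)+

lemma coord_map_affine:
  assumes fin: "finite I" and inj: "inj_on \<sigma> I" and uv: "u + v = (1::real)"
  shows "coord_map I \<sigma> c (u *\<^sub>R x + v *\<^sub>R y) = u *\<^sub>R coord_map I \<sigma> c x + v *\<^sub>R coord_map I \<sigma> c y"
proof (rule poly_mapping_eqI)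
  fix k
  show "lookup (coord_map I \<sigma> c (u *\<^sub>R x + v *\<^sub>R y)) k =
      lookup (u *\<^sub>R coord_map I \<sigma> c x + v *\<^sub>R coord_map I \<sigma> c y) k"
  proof (cases "k \<in> \<sigma> ` I")
    case True
    then obtain i where i: "i \<in> I" "k = \<sigma> i" by blast
    have "c i = u * c i + v * c i" using uv by (simp add: distrib_right[symmetric])
    then show ?thesis using i
      by (simp add: lookup_coord_map[OF fin inj] lookup_add lookup_scaleR_vec algebra_simps)
  next
    case False
    then show ?thesis
      by (simp add: lookup_coord_map[OF fin inj] lookup_add lookup_scaleR_vec)
  qed
qed

lemma
  fixes f :: "'a::real_vector \<Rightarrow> 'b::real_vector"
  assumes f: "\<And>u v x y. u + v = 1 \<Longrightarrow> f (u *\<^sub>R x + v *\<^sub>R y) = u *\<^sub>R f x + v *\<^sub>R f y"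
  shows convex_hull_affine_image: "f ` (convex hull S) = convex hull (f ` S)"
    and affine_hull_affine_image: "f ` (affine hull S) = affine hull (f ` S)"
proof -
  have "convex {x. f x \<in> convex hull (f ` S)}"
    using convex_convex_hull[of "f ` S"] unfolding convex_def by (auto simp: f)
  then have "convex hull S \<subseteq> {x. f x \<in> convex hull (f ` S)}"
    by (rule hull_minimal[rotated]) (auto intro: hull_inc)
  moreover have "convex (f ` (convex hull S))"
    using convex_convex_hull[of S] unfolding convex_def by (auto simp: f[symmetric])
  then have "convex hull (f ` S) \<subseteq> f ` (convex hull S)"
    by (rule hull_minimal[rotated]) (auto intro: hull_inc)
  ultimately show "f ` (convex hull S) = convex hull (f ` S)" by blast
  have "affine {x. f x \<in> affine hull (f ` S)}"
    using affine_affine_hull[of "f ` S"] unfolding affine_def by (auto simp: f)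
  then have "affine hull S \<subseteq> {x. f x \<in> affine hull (f ` S)}"
    by (rule hull_minimal[rotated]) (auto intro: hull_inc)
  moreover have "affine (f ` (affine hull S))"
    using affine_affine_hull[of S] unfolding affine_def by (auto simp: f[symmetric])
  then have "affine hull (f ` S) \<subseteq> f ` (affine hull S)"
    by (rule hull_minimal[rotated]) (auto intro: hull_inc)
  ultimately show "f ` (affine hull S) = affine hull (f ` S)" by blast
qed

lemma affine_coord_support: "affine {x :: vec_fin. Poly_Mapping.keys x \<subseteq> I}"
proof -
  have "{x :: vec_fin. Poly_Mapping.keys x \<subseteq> I} = {x. \<forall>k. k \<notin> I \<longrightarrow> lookup x k = 0}"
    by (auto simp: in_keys_iff)
  then show ?thesis unfolding affine_def by (auto simp: lookup_add lookup_scaleR_vec)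
qed

text \<open>
  On the vectors supported in \<open>I\<close>, such a map is injective and, as the translation is by integers,
  it both preserves and reflects integrality of the coordinates.
\<close>

lemma integrally_equivalent_coord_map:
  assumes V: "finite V" "V \<subseteq> int_lattice p" "\<And>x. x \<in> V \<Longrightarrow> Poly_Mapping.keys x \<subseteq> I"
    and I: "I \<subseteq> {1..p}" "inj_on \<sigma> I" "\<sigma> ` I \<subseteq> {1..q}" and c: "\<And>i. i \<in> I \<Longrightarrow> c i \<in> \<int>"
  shows "integrally_equivalent p (convex hull V) q (convex hull (coord_map I \<sigma> c ` V))"
proof -
  let ?f = "coord_map I \<sigma> c" and ?K = "{x :: vec_fin. Poly_Mapping.keys x \<subseteq> I}"
  have fin: "finite I" using I(1) finite_subset by blast
  note aff = coord_map_affine[OF fin I(2), where c = c]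
  have val: "lookup (?f x) (\<sigma> i) = lookup x i + c i" if "i \<in> I" for x i
    by (rule lookup_coord_map(1)[OF fin I(2) that])
  have val0: "lookup (?f x) k = 0" if "k \<notin> \<sigma> ` I" for x k
    by (rule lookup_coord_map(2)[OF fin I(2) that])
  have lat: "?f x \<in> int_lattice q \<longleftrightarrow> x \<in> int_lattice p" if x: "x \<in> ?K" for x
  proof -
    have x0: "lookup x i = 0" if "i \<notin> I" for i using x that by (auto simp: in_keys_iff)
    have "Poly_Mapping.keys (?f x) \<subseteq> \<sigma> ` I" using val0 by (meson in_keys_iff subsetI)
    then have spaces: "?f x \<in> coord_space q" "x \<in> coord_space p"
      using I(1,3) x unfolding coord_space_def by blast+
    have int_f: "(\<forall>k. lookup (?f x) k \<in> \<int>) \<longleftrightarrow> (\<forall>i\<in>I. lookup x i + c i \<in> \<int>)"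
    proof (intro iffI ballI allI)
      show "lookup x i + c i \<in> \<int>" if "\<forall>k. lookup (?f x) k \<in> \<int>" "i \<in> I" for i
        using that(1) val[OF that(2), symmetric] by simp
      show "lookup (?f x) k \<in> \<int>" if "\<forall>i\<in>I. lookup x i + c i \<in> \<int>" for k
        using that val val0[of k] by (cases "k \<in> \<sigma> ` I") auto
    qed
    have "lookup x i + c i \<in> \<int> \<longleftrightarrow> lookup x i \<in> \<int>" if "i \<in> I" for i
    proof
      show "lookup x i \<in> \<int>" if "lookup x i + c i \<in> \<int>"
        using Ints_diff[OF that c[OF \<open>i \<in> I\<close>]] by simp
      show "lookup x i + c i \<in> \<int>" if "lookup x i \<in> \<int>"
        using Ints_add[OF that c[OF \<open>i \<in> I\<close>]] .
    qed
    moreover have "lookup x i \<in> \<int>" if "i \<notin> I" for i using x0[OF that] by simp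
    ultimately have "(\<forall>i\<in>I. lookup x i + c i \<in> \<int>) \<longleftrightarrow> (\<forall>i. lookup x i \<in> \<int>)" by blast
    then show ?thesis using spaces int_f by (simp add: int_lattice_def)
  qed
  have inj: "inj_on ?f ?K"
  proof (rule inj_onI)
    fix x y assume xy: "x \<in> ?K" "y \<in> ?K" "?f x = ?f y"
    show "x = y"
    proof (rule poly_mapping_eqI)
      fix k show "lookup x k = lookup y k"
      proof (cases "k \<in> I")
        case True
        then show ?thesis using val[of k x] val[of k y] xy(3) by simp
      next
        case False
        then have "k \<notin> Poly_Mapping.keys x" "k \<notin> Poly_Mapping.keys y" using xy by auto
        then show ?thesis by (simp add: in_keys_iff)
      qed
    qed
  qed
  have VK: "V \<subseteq> ?K" using V(3) by blast
  have AK: "affine hull V \<subseteq> ?K" by (intro hull_minimal VK affine_coord_support)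
  have injA: "inj_on ?f (affine hull V)" using inj_on_subset[OF inj AK] .
  have imA: "?f ` (affine hull V) = affine hull (?f ` V)" by (rule affine_hull_affine_image[OF aff])
  have imC: "?f ` (convex hull V) = convex hull (?f ` V)" by (rule convex_hull_affine_image[OF aff])
  have imL: "?f ` (affine hull V \<inter> int_lattice p) = affine hull (?f ` V) \<inter> int_lattice q"
    unfolding imA[symmetric] using lat AK by blast
  have "?f ` V \<subseteq> int_lattice q" using lat VK V(2) by blast
  then have "lattice_polytope p (convex hull V)" "lattice_polytope q (convex hull (?f ` V))"
    unfolding lattice_polytope_def using V by blast+
  moreover have "affine_map_on (affine hull V) ?f" unfolding affine_map_on_def using aff by simp
  moreover have "bij_betw ?f (affine hull V \<inter> int_lattice p) (affine hull (?f ` V) \<inter> int_lattice q)"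
    unfolding bij_betw_def using imL inj_on_subset[OF injA] by blast
  moreover have "bij_betw ?f (affine hull V) (affine hull (?f ` V))"
    unfolding bij_betw_def using imA injA by blast
  ultimately show ?thesis
    unfolding integrally_equivalent_def affine_hull_convex_hull using imC by blast
qed

section \<open>Integrality of order polytopes\<close>

text \<open>
  The polytope of functions \<open>I \<rightarrow> [0,1]\<close> that are monotone along \<open>R\<close> is the convex hull of its
  points with values in \<open>{0,1}\<close>; this is stated for the image under an affine map \<open>F\<close>.  If \<open>\<mu>\<close> is the
  smallest positive value of \<open>s\<close>, then \<open>s\<close> is a convex combination, with weight \<open>\<mu>\<close>, of the indicator
  function of its support and of a monotone function that has fewer positive values.
\<close>

lemma order_polytope_integral:
  fixes F :: "('i \<Rightarrow> real) \<Rightarrow> 'v::real_vector"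
  assumes I: "finite I" and K: "convex K"
    and F: "\<And>u s t. F (\<lambda>i. (1 - u) * s i + u * t i) = (1 - u) *\<^sub>R F s + u *\<^sub>R F t"
    and vertex: "\<And>s. (\<And>i. s i \<in> {0, 1}) \<Longrightarrow> (\<And>i. i \<notin> I \<Longrightarrow> s i = 0) \<Longrightarrow>
      (\<And>i j. R i j \<Longrightarrow> s i \<le> s j) \<Longrightarrow> F s \<in> K"
    and s: "\<And>i. 0 \<le> s i \<and> s i \<le> 1" "\<And>i. i \<notin> I \<Longrightarrow> s i = 0" "\<And>i j. R i j \<Longrightarrow> s i \<le> s j"
  shows "F s \<in> K"
  using s
proof (induction "card (s ` I - {0})" arbitrary: s rule: less_induct)
  case less
  note s = less.prems
  let ?P = "s ` I - {0}"
  show ?case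
  proof (cases "?P = {}")
    case True
    then have "s i = 0" for i using s(2)[of i] by (cases "i \<in> I") auto
    then show ?thesis using s by (intro vertex) auto
  next
    case False
    define \<mu> where "\<mu> = Min ?P"
    have finP: "finite ?P" using I by simp
    have \<mu>P: "\<mu> \<in> ?P" unfolding \<mu>_def using finP False by (rule Min_in)
    then have \<mu>: "0 < \<mu>" "\<mu> \<le> 1" using s(1) by (auto simp: less_le)
    have gap: "s i = 0 \<or> \<mu> \<le> s i" for i
      using s(2)[of i] Min_le[OF finP, of "s i"] unfolding \<mu>_def by (cases "i \<in> I") auto
    define t where "t = (\<lambda>i. if s i = 0 then 0 else 1 :: real)"
    have tK: "F t \<in> K"
    proof (rule vertex)
      show "t i \<le> t j" if "R i j" for i j
        using s(3)[OF that] s(1)[of i] s(1)[of j] unfolding t_def by auto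
    qed (use s(2) in \<open>auto simp: t_def\<close>)
    show ?thesis
    proof (cases "\<mu> = 1")
      case True
      have "s i = t i" for i using gap[of i] s(1)[of i] True unfolding t_def by auto
      then have "s = t" by blast
      then show ?thesis using tK by simp
    next
      case False
      then have \<mu>1: "\<mu> < 1" using \<mu> by simp
      \<comment> \<open>The rescaled remainder: \<open>s = (1 - \<mu>) * (\<phi> \<circ> s) + \<mu> * t\<close>, and \<open>\<phi>\<close> sends \<open>\<mu>\<close> to \<open>0\<close>.\<close>
      define \<phi> where "\<phi> = (\<lambda>v. if v = 0 then 0 else (v - \<mu>) / (1 - \<mu>))"
      let ?s' = "\<lambda>i. \<phi> (s i)"
      have "?s' ` I - {0} \<subseteq> \<phi> ` (?P - {\<mu>})" unfolding \<phi>_def by auto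
      then have "card (?s' ` I - {0}) \<le> card (?P - {\<mu>})"
        using finP by (meson card_image_le card_mono finite_Diff finite_imageI order_trans)
      also have "\<dots> < card ?P" using \<mu>P finP by (rule card_Diff1_less[rotated])
      finally have smaller: "card (?s' ` I - {0}) < card ?P" .
      have "F ?s' \<in> K"
      proof (rule less.hyps[OF smaller])
        show "0 \<le> ?s' i \<and> ?s' i \<le> 1" for i
          using gap[of i] s(1)[of i] \<mu>1 unfolding \<phi>_def by auto
        show "?s' i = 0" if "i \<notin> I" for i using s(2)[OF that] unfolding \<phi>_def by simp
        show "?s' i \<le> ?s' j" if "R i j" for i j
          using gap[of i] gap[of j] s(3)[OF that] s(1)[of i] \<mu> \<mu>1 unfolding \<phi>_def
          by (auto simp: divide_right_mono)
      qed
      moreover have "(1 - \<mu>) * ?s' i + \<mu> * t i = s i" for i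
        using \<mu>1 unfolding \<phi>_def t_def by auto
      then have "F s = (1 - \<mu>) *\<^sub>R F ?s' + \<mu> *\<^sub>R F t" using F[of \<mu> ?s' t] by simp
      ultimately show ?thesis using convexD[OF K _ tK, of "F ?s'" "1 - \<mu>" \<mu>] \<mu> by simp
    qed
  qed
qed

section \<open>Shard polytopes are order polytopes\<close>

definition psum :: "vec_fin \<Rightarrow> nat \<Rightarrow> real" where
  "psum x k = (\<Sum>i=1..k. lookup x i)"

lemma psum_0 [simp]: "psum x 0 = 0"
  by (simp add: psum_def)

lemma psum_Suc: "psum x (Suc k) = psum x k + lookup x (Suc k)"
  by (simp add: psum_def)

lemma psum_pred: "0 < k \<Longrightarrow> psum x k = psum x (k - 1) + lookup x k"
  using psum_Suc[of x "k - 1"] by simp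

lemma psum_affine: "psum (u *\<^sub>R x + v *\<^sub>R y) k = u * psum x k + v * psum y k"
  by (simp add: psum_def lookup_add lookup_scaleR_vec sum.distrib sum_distrib_left)

lemma psum_diff: "psum (x - y) k = psum x k - psum y k"
  by (simp add: psum_def lookup_minus sum_subtractf)

lemma psum_outside:
  assumes "Poly_Mapping.keys x \<subseteq> {a..b}"
  shows "k < a \<Longrightarrow> psum x k = 0" and "b \<le> k \<Longrightarrow> psum x k = psum x b"
proof -
  have 0: "lookup x i = 0" if "i \<notin> {a..b}" for i using that assms by (auto simp: in_keys_iff)
  show "psum x k = 0" if "k < a" using that 0 unfolding psum_def by (intro sum.neutral) auto
  show "psum x k = psum x b" if "b \<le> k"
    using that by (induction k rule: dec_induct) (auto simp: psum_Suc 0)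
qed

lemma psum_indicator_vec:
  assumes "finite C"
  shows "psum (indicator_vec C) k = real (cnt C k)"
  using assms by (induction k) (simp_all add: psum_Suc cnt_Suc lookup_indicator_vec)

text \<open>
  Rises are falls after exchanging \<open>A\<close> and \<open>B\<close>, so that the lower bound on the partial sums follows from
  the upper bound applied to their negatives.
\<close>

lemma arc_rises_eq_falls: "arc_rises a b A B = arc_falls a b B A"
  by (simp add: arc_rises_def arc_falls_def)

text \<open>
  If \<open>s\<close> increases along \<open>A\<close> and decreases along \<open>B\<close>, then its local maxima are at the
  falls, so a bound there holds everywhere on the interval.
\<close>

lemma le_of_falls:
  fixes s :: "nat \<Rightarrow> real"
  assumes ab: "A \<union> B = {a+1..b-1}"
    and A: "\<And>i. i \<in> A \<Longrightarrow> s (i - 1) \<le> s i" and B: "\<And>i. i \<in> B \<Longrightarrow> s i \<le> s (i - 1)"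
    and falls: "\<And>f. f \<in> arc_falls a b A B \<Longrightarrow> s f \<le> c"
    and k: "a \<le> k" "k < b"
  shows "s k \<le> c"
proof -
  \<comment> \<open>From a position in \<open>{a} \<union> A\<close>, climb to the right until the next fall.\<close>
  have peak: "s k \<le> c" if "k \<in> {a} \<union> A" "a \<le> k" "k < b" for k
    using that(3,1,2)
  proof (induction "b - k" arbitrary: k)
    case (Suc d)
    show ?case
    proof (cases "Suc k \<in> A")
      case True
      have "Suc k \<in> {a+1..b-1}" using True unfolding ab[symmetric] by blast
      then have "Suc k < b" by auto
      then have "s (Suc k) \<le> c" using Suc True by auto
      then show ?thesis using A[OF True] by simp
    next
      case False
      have "Suc k = b \<or> Suc k \<in> {a+1..b-1}" using Suc.prems by auto
      then have "k \<in> arc_falls a b A B"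
        using False Suc.prems unfolding ab[symmetric] arc_falls_def by auto
      then show ?thesis by (rule falls)
    qed
  qed simp
  show ?thesis using k
  proof (induction k rule: dec_induct)
    case base
    then show ?case using peak[of a] by simp
  next
    case (step k)
    show ?case
    proof (cases "Suc k \<in> A")
      case True
      then show ?thesis using peak[of "Suc k"] step by simp
    next
      case False
      have "Suc k \<in> {a+1..b-1}" using step by auto
      then have "Suc k \<in> B" using False ab by blast
      then show ?thesis using B[of "Suc k"] step by simp
    qed
  qed
qed

lemma arc_interior: "shard_arc n a b A B \<Longrightarrow> i \<in> A \<or> i \<in> B \<longleftrightarrow> a < i \<and> i < b"
proof -
  assume arc: "shard_arc n a b A B"
  then have "i \<in> A \<or> i \<in> B \<longleftrightarrow> i \<in> {a+1..b-1}" unfolding shard_arc_def by blast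
  moreover have "a < b" using arc unfolding shard_arc_def by blast
  ultimately show ?thesis by auto
qed

lemma arc_north_subset:
  assumes "shard_arc n a b A B"
  shows "B \<union> {b} \<subseteq> {a..b}" "a \<notin> B \<union> {b}"
proof -
  have "a < i \<and> i \<le> b" if "i \<in> B \<union> {b}" for i
    using arc_interior[OF assms, of i] assms that unfolding shard_arc_def by auto
  then show "B \<union> {b} \<subseteq> {a..b}" "a \<notin> B \<union> {b}" by fastforce+
qed

text \<open>
  In terms of its partial sums, the shard polytope is the order polytope of a zigzag on the
  positions \<open>a, \<dots>, b - 1\<close>: consecutive values are compared in one direction along \<open>A\<close>
  and in the other along \<open>B\<close>.
\<close>

lemma shard_polytope_iff:
  assumes arc: "shard_arc n a b A B"
  shows "x \<in> shard_polytope n a b A B \<longleftrightarrow> Poly_Mapping.keys x \<subseteq> {a..b} \<and> psum x b = 0 \<and>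
    (\<forall>k. a \<le> k \<and> k < b \<longrightarrow> 0 \<le> psum x k \<and> psum x k \<le> 1) \<and>
    (\<forall>i\<in>A. 0 \<le> lookup x i) \<and> (\<forall>i\<in>B. lookup x i \<le> 0)" (is "_ \<longleftrightarrow> ?r")
proof
  have ab: "1 \<le> a" "a < b" "b \<le> n" and AB: "A \<union> B = {a+1..b-1}"
    using arc unfolding shard_arc_def by auto
  {
    assume x: "x \<in> shard_polytope n a b A B"
    have keys: "Poly_Mapping.keys x \<subseteq> {a..b}"
    proof
      fix i assume i: "i \<in> Poly_Mapping.keys x"
      then have "i \<in> {1..n}" using x unfolding shard_polytope_def coord_space_def by blast
      then show "i \<in> {a..b}" using x i unfolding shard_polytope_def by (auto simp: in_keys_iff)
    qed
    have "psum x n = 0" using x unfolding shard_polytope_def psum_def by simp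
    then have at_b: "psum x b = 0" using psum_outside(2)[OF keys ab(3)] by simp
    have A: "\<And>i. i \<in> A \<Longrightarrow> 0 \<le> lookup x i" and B: "\<And>i. i \<in> B \<Longrightarrow> lookup x i \<le> 0"
      using x unfolding shard_polytope_def by auto
    have pos: "0 < i" if "i \<in> A \<union> B" for i using that arc_interior[OF arc, of i] by auto
    have "psum x k \<le> 1" if "a \<le> k" "k < b" for k
    proof (rule le_of_falls[OF AB _ _ _ that])
      show "psum x (i - 1) \<le> psum x i" if "i \<in> A" for i
        using A[OF that] psum_pred[of i x] pos[of i] that by simp
      show "psum x i \<le> psum x (i - 1)" if "i \<in> B" for i
        using B[OF that] psum_pred[of i x] pos[of i] that by simp
      show "psum x f \<le> 1" if "f \<in> arc_falls a b A B" for f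
        using x that unfolding shard_polytope_def psum_def by blast
    qed
    moreover have "- psum x k \<le> 0" if "a \<le> k" "k < b" for k
    proof (rule le_of_falls[OF _ _ _ _ that])
      show "B \<union> A = {a+1..b-1}" using AB by blast
      show "- psum x (i - 1) \<le> - psum x i" if "i \<in> B" for i
        using B[OF that] psum_pred[of i x] pos[of i] that by simp
      show "- psum x i \<le> - psum x (i - 1)" if "i \<in> A" for i
        using A[OF that] psum_pred[of i x] pos[of i] that by simp
      show "- psum x f \<le> 0" if "f \<in> arc_falls a b B A" for f
        using x that unfolding shard_polytope_def psum_def arc_rises_eq_falls by simp
    qed
    ultimately show ?r using keys at_b A B by simp
  }
  {
    assume r: ?r
    then have keys: "Poly_Mapping.keys x \<subseteq> {a..b}" by blast
    have "x \<in> coord_space n" using keys ab unfolding coord_space_def by force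
    moreover have "(\<Sum>i=1..n. lookup x i) = 0"
      using psum_outside(2)[OF keys ab(3)] r unfolding psum_def by simp
    moreover have "\<forall>i\<in>{1..n} - {a..b}. lookup x i = 0"
      using keys by (auto simp: in_keys_iff)
    moreover have "\<forall>f\<in>arc_falls a b A B. (\<Sum>i=1..f. lookup x i) \<le> 1"
      using r ab unfolding arc_falls_def psum_def by auto
    moreover have "\<forall>f\<in>arc_rises a b A B. 0 \<le> (\<Sum>i=1..f. lookup x i)"
      using r ab unfolding arc_rises_def psum_def by auto
    ultimately show "x \<in> shard_polytope n a b A B" using r unfolding shard_polytope_def by simp
  }
qed

text \<open>
  The bases of a snake matroid, on the ground set \<open>{a..b}\<close> instead of \<open>{1..N}\<close>.
\<close>

definition snake_bases :: "nat \<Rightarrow> nat \<Rightarrow> nat set \<Rightarrow> nat set set" where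
  "snake_bases a b T = {C. C \<subseteq> {a..b} \<and>
     (\<forall>k. cnt T k \<le> cnt C k \<and> cnt C k \<le> cnt T k + of_bool (a \<le> k \<and> k < b))}"

lemma snake_base_vertex:
  assumes arc: "shard_arc n a b A B" and C: "C \<in> snake_bases a b (B \<union> {b})"
  shows "indicator_vec C - indicator_vec (B \<union> {b}) \<in> shard_polytope n a b A B \<inter> int_lattice n"
proof -
  let ?T = "B \<union> {b}" and ?x = "indicator_vec C - indicator_vec (B \<union> {b})"
  have ab: "1 \<le> a" "a < b" "b \<le> n" and AB: "A \<union> B = {a+1..b-1}" "A \<inter> B = {}"
    using arc unfolding shard_arc_def by auto
  have T: "?T \<subseteq> {a..b}" by (rule arc_north_subset[OF arc])
  have CT: "C \<subseteq> {a..b}" and bd: "\<And>k. cnt ?T k \<le> cnt C k"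
    "\<And>k. cnt C k \<le> cnt ?T k + of_bool (a \<le> k \<and> k < b)"
    using C unfolding snake_bases_def by auto
  have fin: "finite C" "finite ?T" using CT T finite_subset by blast+
  have val: "lookup ?x i = of_bool (i \<in> C) - of_bool (i \<in> ?T)" for i
    by (simp only: lookup_minus lookup_indicator_vec[OF fin(1)] lookup_indicator_vec[OF fin(2)])
  have ps: "psum ?x k = real (cnt C k) - real (cnt ?T k)" for k
    by (simp only: psum_diff psum_indicator_vec[OF fin(1)] psum_indicator_vec[OF fin(2)])
  have keys: "Poly_Mapping.keys ?x \<subseteq> {a..b}"
  proof
    fix i assume "i \<in> Poly_Mapping.keys ?x"
    then have "lookup ?x i \<noteq> 0" by (simp only: in_keys_iff not_False_eq_True)
    then have "i \<in> C \<union> ?T" unfolding val by (auto split: if_splits)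
    then show "i \<in> {a..b}" using CT T by blast
  qed
  have "?x \<in> shard_polytope n a b A B"
    unfolding shard_polytope_iff[OF arc]
  proof (intro conjI allI impI ballI keys)
    show "psum ?x b = 0" using bd(1)[of b] bd(2)[of b] unfolding ps by simp
    show "0 \<le> psum ?x k" "psum ?x k \<le> 1" if "a \<le> k \<and> k < b" for k
      using bd(1)[of k] bd(2)[of k] that unfolding ps by simp_all
    show "0 \<le> lookup ?x i" if "i \<in> A" for i
    proof -
      have "i \<notin> ?T" using that AB(2) arc_interior[OF arc, of i] by auto
      then show ?thesis unfolding val by simp
    qed
    show "lookup ?x i \<le> 0" if "i \<in> B" for i using that unfolding val by simp
  qed
  moreover have "?x \<in> int_lattice n"
  proof -
    have "?x \<in> coord_space n" using keys ab unfolding coord_space_def by force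
    then show ?thesis unfolding int_lattice_def using val by simp
  qed
  ultimately show ?thesis by blast
qed

lemma Ints_unit_interval:
  fixes v :: real
  assumes "v \<in> \<int>" "0 \<le> v" "v \<le> 1"
  shows "v = of_bool (v = 1)"
  using assms by (elim Ints_cases) auto

text \<open>
  An integral point of the shard polytope has partial sums \<open>0\<close> or \<open>1\<close>, so its entries are
  differences of the steps of two paths: the path \<open>B \<union> {b}\<close> and one that is never below it and at most
  one above it.
\<close>

lemma shard_lattice_points:
  assumes arc: "shard_arc n a b A B"
  shows "shard_polytope n a b A B \<inter> int_lattice n =
    (\<lambda>C. indicator_vec C - indicator_vec (B \<union> {b})) ` snake_bases a b (B \<union> {b})"
proof (intro set_eqI iffI)
  let ?T = "B \<union> {b}"
  have ab: "1 \<le> a" "a < b" "b \<le> n" and AB: "A \<union> B = {a+1..b-1}" "A \<inter> B = {}"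
    using arc unfolding shard_arc_def by auto
  have T: "?T \<subseteq> {a..b}" by (rule arc_north_subset[OF arc])
  have aT: "a \<notin> ?T" by (rule arc_north_subset[OF arc])
  fix x assume x: "x \<in> shard_polytope n a b A B \<inter> int_lattice n"
  then have keys: "Poly_Mapping.keys x \<subseteq> {a..b}" and at_b: "psum x b = 0"
    and bd: "\<And>k. a \<le> k \<Longrightarrow> k < b \<Longrightarrow> 0 \<le> psum x k \<and> psum x k \<le> 1"
    and A: "\<And>i. i \<in> A \<Longrightarrow> 0 \<le> lookup x i" and B: "\<And>i. i \<in> B \<Longrightarrow> lookup x i \<le> 0"
    unfolding shard_polytope_iff[OF arc] Int_iff by auto
  have int: "lookup x i \<in> \<int>" for i using x unfolding int_lattice_def by blast
  define C where "C = {i \<in> {a..b}. lookup x i + of_bool (i \<in> ?T) = 1}"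
  have val: "lookup x i + of_bool (i \<in> ?T) = of_bool (i \<in> C)" for i
  proof (cases "i \<in> {a..b}")
    case True
    have step: "psum x i = psum x (i - 1) + lookup x i" using True ab by (intro psum_pred) auto
    consider "i = a" | "i = b" | "i \<in> A" | "i \<in> B" using True arc_interior[OF arc, of i] by force
    then have "0 \<le> lookup x i + of_bool (i \<in> ?T) \<and> lookup x i + of_bool (i \<in> ?T) \<le> 1"
    proof cases
      case 1
      then show ?thesis using step psum_outside(1)[OF keys, of "i - 1"] bd[of a] ab aT by simp
    next
      case 2
      moreover have "a \<le> b - 1" "b - 1 < b" using ab by auto
      ultimately show ?thesis using step at_b bd[of "b - 1"] by simp
    next
      case 3
      have i: "a < i" "i < b" using 3 arc_interior[OF arc, of i] by auto
      then have "i \<notin> ?T" using 3 AB(2) by auto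
      moreover have "a \<le> i - 1" "i - 1 < b" using i by auto
      ultimately show ?thesis using step A[OF 3] bd[of i] bd[of "i - 1"] i by simp
    next
      case 4
      have i: "a < i" "i < b" using 4 arc_interior[OF arc, of i] by auto
      moreover have "a \<le> i - 1" "i - 1 < b" using i by auto
      ultimately show ?thesis using step B[OF 4] 4 bd[of i] bd[of "i - 1"] by simp
    qed
    moreover have "lookup x i + of_bool (i \<in> ?T) \<in> \<int>" using int[of i] by simp
    ultimately have "lookup x i + of_bool (i \<in> ?T) = of_bool (lookup x i + of_bool (i \<in> ?T) = 1)"
      by (intro Ints_unit_interval) auto
    then show ?thesis using True unfolding C_def by simp
  next
    case False
    then have "i \<notin> Poly_Mapping.keys x" "i \<notin> ?T" "i \<notin> C" using keys T unfolding C_def by blast+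
    then show ?thesis by (simp add: in_keys_iff)
  qed
  have CT: "C \<subseteq> {a..b}" unfolding C_def by blast
  have fin: "finite C" "finite ?T" using CT T finite_subset by blast+
  have eq: "x = indicator_vec C - indicator_vec ?T"
  proof (rule poly_mapping_eqI)
    fix i
    show "lookup x i = lookup (indicator_vec C - indicator_vec ?T) i"
      using val[of i]
      by (simp only: lookup_minus lookup_indicator_vec[OF fin(1)] lookup_indicator_vec[OF fin(2)])
  qed
  have ps: "psum x k = real (cnt C k) - real (cnt ?T k)" for k
    unfolding eq
    by (simp only: psum_diff psum_indicator_vec[OF fin(1)] psum_indicator_vec[OF fin(2)])
  have "cnt ?T k \<le> cnt C k \<and> cnt C k \<le> cnt ?T k + of_bool (a \<le> k \<and> k < b)" for k
  proof -
    consider "k < a" | "a \<le> k" "k < b" | "b \<le> k" by linarith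
    then show ?thesis
    proof cases
      case 1
      then show ?thesis using ps[of k] psum_outside(1)[OF keys 1] by simp
    next
      case 2
      then show ?thesis using ps[of k] bd[of k] by simp
    next
      case 3
      then show ?thesis using ps[of k] psum_outside(2)[OF keys 3] at_b by simp
    qed
  qed
  then have "C \<in> snake_bases a b ?T" using CT unfolding snake_bases_def by blast
  then show "x \<in> (\<lambda>C. indicator_vec C - indicator_vec ?T) ` snake_bases a b ?T"
    unfolding eq by blast
next
  fix x assume "x \<in> (\<lambda>C. indicator_vec C - indicator_vec (B \<union> {b})) ` snake_bases a b (B \<union> {b})"
  then show "x \<in> shard_polytope n a b A B \<inter> int_lattice n"
    using snake_base_vertex[OF arc] by blast
qed

lemma convex_shard_polytope:
  assumes arc: "shard_arc n a b A B"
  shows "convex (shard_polytope n a b A B)"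
  unfolding convex_def
proof (intro ballI allI impI)
  fix x y and u v :: real
  assume x: "x \<in> shard_polytope n a b A B" and y: "y \<in> shard_polytope n a b A B"
    and uv: "0 \<le> u" "0 \<le> v" "u + v = 1"
  have "Poly_Mapping.keys (u *\<^sub>R x + v *\<^sub>R y) \<subseteq> {a..b}"
    using x y uv affine_coord_support[of "{a..b}"] unfolding shard_polytope_iff[OF arc] affine_def by blast
  moreover have "u * psum x k + v * psum y k \<le> 1" if "a \<le> k \<and> k < b" for k
    using x y that uv unfolding shard_polytope_iff[OF arc] by (intro convex_bound_le) auto
  moreover have "u * lookup x i + v * lookup y i \<le> 0" if "i \<in> B" for i
    using x y that uv unfolding shard_polytope_iff[OF arc] by (intro convex_bound_le) auto
  ultimately show "u *\<^sub>R x + v *\<^sub>R y \<in> shard_polytope n a b A B"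
    using x y uv unfolding shard_polytope_iff[OF arc] psum_affine
    by (simp add: lookup_add lookup_scaleR_vec)
qed

lemma shard_polytope_integral:
  assumes arc: "shard_arc n a b A B"
  shows "shard_polytope n a b A B = convex hull (shard_polytope n a b A B \<inter> int_lattice n)"
    (is "?P = convex hull ?V")
proof
  show "convex hull ?V \<subseteq> ?P"
    by (rule hull_minimal) (auto simp: convex_shard_polytope[OF arc])
  have ab: "1 \<le> a" "a < b" "b \<le> n" and AB: "A \<union> B = {a+1..b-1}"
    using arc unfolding shard_arc_def by auto
  have AB_bounds: "a < i \<and> i < b" if "i \<in> A \<union> B" for i using that arc_interior[OF arc, of i] by auto
  \<comment> \<open>The inverse of taking partial sums.\<close>
  define F :: "(nat \<Rightarrow> real) \<Rightarrow> vec_fin" where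
    "F s = (\<Sum>i\<in>{a..b}. Poly_Mapping.single i (s i - s (i - 1)))" for s
  define R where "R i j \<longleftrightarrow> (j \<in> A \<and> i = j - 1) \<or> (i \<in> B \<and> j = i - 1)" for i j
  have F_lookup: "lookup (F s) i = (if i \<in> {a..b} then s i - s (i - 1) else 0)" for s i
    unfolding F_def using lookup_sum_single[of "{a..b}" "\<lambda>i. i"] by auto
  have F_affine: "F (\<lambda>i. (1 - u) * s i + u * t i) = (1 - u) *\<^sub>R F s + u *\<^sub>R F t" for u s t
    by (rule poly_mapping_eqI) (simp add: lookup_add lookup_scaleR_vec F_lookup, simp add: algebra_simps)
  have F_psum: "psum (F s) k = s k" if s0: "\<And>i. i \<notin> {a..<b} \<Longrightarrow> s i = 0" for s k
  proof (induction k)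
    case 0
    show ?case using s0[of 0] ab by simp
  next
    case (Suc k)
    have "Suc k \<notin> {a..b} \<Longrightarrow> s (Suc k) = s k" using s0[of k] s0[of "Suc k"] by auto
    then show ?case using Suc by (auto simp: psum_Suc F_lookup)
  qed
  have F_keys: "Poly_Mapping.keys (F s) \<subseteq> {a..b}" for s
    by (auto simp: in_keys_iff F_lookup split: if_splits)
  have vertex: "F s \<in> convex hull ?V"
    if s01: "\<And>i. s i \<in> {0, 1}" and s0: "\<And>i. i \<notin> {a..<b} \<Longrightarrow> s i = 0"
      and mono: "\<And>i j. R i j \<Longrightarrow> s i \<le> s j" for s
  proof -
    have "F s \<in> ?P" unfolding shard_polytope_iff[OF arc]
    proof (intro conjI allI impI ballI F_keys)
      show "psum (F s) b = 0" using F_psum[OF s0] s0[of b] by simp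
      show "0 \<le> psum (F s) k" "psum (F s) k \<le> 1" for k
        using F_psum[OF s0] s01[of k] by auto
      show "0 \<le> lookup (F s) i" if "i \<in> A" for i
        using that mono[of "i - 1" i] AB_bounds[of i] unfolding F_lookup R_def by auto
      show "lookup (F s) i \<le> 0" if "i \<in> B" for i
        using that mono[of i "i - 1"] AB_bounds[of i] unfolding F_lookup R_def by auto
    qed
    moreover have "F s \<in> int_lattice n"
    proof -
      have "s i \<in> \<int>" for i using s01[of i] by auto
      then have "lookup (F s) i \<in> \<int>" for i unfolding F_lookup by simp
      moreover have "F s \<in> coord_space n" using F_keys[of s] ab unfolding coord_space_def by force
      ultimately show ?thesis unfolding int_lattice_def by simp
    qed
    ultimately show ?thesis by (intro hull_inc) blast
  qed
  show "?P \<subseteq> convex hull ?V"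
  proof
    fix x assume x: "x \<in> ?P"
    then have keys: "Poly_Mapping.keys x \<subseteq> {a..b}" and at_b: "psum x b = 0"
      and bd: "\<And>k. a \<le> k \<Longrightarrow> k < b \<Longrightarrow> 0 \<le> psum x k \<and> psum x k \<le> 1"
      and A: "\<And>i. i \<in> A \<Longrightarrow> 0 \<le> lookup x i" and B: "\<And>i. i \<in> B \<Longrightarrow> lookup x i \<le> 0"
      unfolding shard_polytope_iff[OF arc] by auto
    have out: "psum x k = 0" if "k \<notin> {a..<b}" for k
      using psum_outside[OF keys, of k] that at_b by (cases "k < a") auto
    have "F (psum x) \<in> convex hull ?V"
    proof (rule order_polytope_integral[where I = "{a..<b}" and R = R and F = F])
      show "0 \<le> psum x i \<and> psum x i \<le> 1" for i
        using bd[of i] out[of i] by (cases "i \<in> {a..<b}") auto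
      show "psum x i \<le> psum x j" if "R i j" for i j
        using that A[of j] B[of i] AB_bounds[of i] AB_bounds[of j] psum_pred[of i x] psum_pred[of j x]
        unfolding R_def by auto
    qed (use F_affine vertex out in auto)
    moreover have "F (psum x) = x"
    proof (rule poly_mapping_eqI)
      fix i
      show "lookup (F (psum x)) i = lookup x i"
        using psum_pred[of i x] ab keys unfolding F_lookup by (auto simp: in_keys_iff)
    qed
    ultimately show "x \<in> convex hull ?V" by simp
  qed
qed


section \<open>Shard polytopes and snake matroids\<close>

lemma cnt_shift_image:
  assumes "C \<subseteq> {a..b}" "1 \<le> a"
  shows "cnt ((\<lambda>i. i - (a - 1)) ` C) k = cnt C (k + (a - 1))"
proof -
  let ?s = "\<lambda>i. i - (a - 1)"
  have "?s ` C \<inter> {1..k} = ?s ` (C \<inter> {1..k + (a - 1)})"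
    using assms by (force simp: subset_iff)
  moreover have "inj_on ?s (C \<inter> {1..k + (a - 1)})"
    using assms by (force simp: inj_on_def subset_iff)
  ultimately show ?thesis unfolding cnt_def by (simp add: card_image)
qed

text \<open>
  Positions before \<open>a\<close> do not contribute to heights, so the shift of the ground set by \<open>a - 1\<close> is a
  shift of the argument of the height function.
\<close>

lemma snake_bases_shift:
  assumes a: "1 \<le> a" "a < b" and T: "T \<subseteq> {a..b}"
  defines "\<sigma> \<equiv> \<lambda>i. i - (a - 1)"
  shows "bases (snake_path_matroid (b + 1 - a) (\<sigma> ` T)) = (\<lambda>C. \<sigma> ` C) ` snake_bases a b T"
proof -
  have iff: "\<sigma> ` C \<in> bases (snake_path_matroid (b + 1 - a) (\<sigma> ` T)) \<longleftrightarrow> C \<in> snake_bases a b T"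
    if C: "C \<subseteq> {a..b}" for C
  proof -
    have sub: "\<sigma> ` C \<subseteq> {1..b + 1 - a}" using C a unfolding \<sigma>_def by (force simp: subset_iff)
    note cntC = cnt_shift_image[OF C a(1), folded \<sigma>_def] and cntT = cnt_shift_image[OF T a(1), folded \<sigma>_def]
    have zero: "cnt D k = 0" if "D \<subseteq> {a..b}" "k < a" for D k
    proof -
      have "D \<inter> {1..k} = {}" using that by fastforce
      then show ?thesis by (simp add: cnt_def)
    qed
    have "(\<forall>k. cnt T (k + (a - 1)) \<le> cnt C (k + (a - 1)) \<and>
          cnt C (k + (a - 1)) \<le> cnt T (k + (a - 1)) + of_bool (1 \<le> k \<and> k < b + 1 - a)) \<longleftrightarrow>
        (\<forall>k. cnt T k \<le> cnt C k \<and> cnt C k \<le> cnt T k + of_bool (a \<le> k \<and> k < b))"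
      (is "(\<forall>k. ?l k) \<longleftrightarrow> (\<forall>k. ?r k)")
    proof -
      have eq: "?l k \<longleftrightarrow> ?r (k + (a - 1))" for k
      proof -
        have "1 \<le> k \<and> k < b + 1 - a \<longleftrightarrow> a \<le> k + (a - 1) \<and> k + (a - 1) < b" using a by auto
        then show ?thesis by simp
      qed
      have "?r k" if "\<forall>k. ?l k" for k
      proof (cases "k < a")
        case True
        then show ?thesis using zero[OF C True] zero[OF T True] by simp
      next
        case False
        then have "k = (k - (a - 1)) + (a - 1)" by simp
        then show ?thesis using that eq[of "k - (a - 1)"] by metis
      qed
      then show ?thesis using eq by blast
    qed
    then show ?thesis using C sub
      unfolding bases_snake_path_matroid snake_bases_def mem_Collect_eq cntC cntT by blast
  qed
  show ?thesis
  proof (intro set_eqI iffI)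
    fix C' assume C': "C' \<in> bases (snake_path_matroid (b + 1 - a) (\<sigma> ` T))"
    define C where "C = (\<lambda>i. i + (a - 1)) ` C'"
    have "C' \<subseteq> {1..b + 1 - a}" using C' unfolding bases_snake_path_matroid by blast
    then have "C \<subseteq> {a..b}" using a unfolding C_def by (force simp: subset_iff)
    moreover have eq: "C' = \<sigma> ` C" unfolding C_def \<sigma>_def image_image by simp
    ultimately have "C \<in> snake_bases a b T" using iff[of C] C' by simp
    then show "C' \<in> (\<lambda>C. \<sigma> ` C) ` snake_bases a b T" unfolding eq by (rule imageI)
  next
    fix C' assume "C' \<in> (\<lambda>C. \<sigma> ` C) ` snake_bases a b T"
    then obtain C where C: "C \<in> snake_bases a b T" "C' = \<sigma> ` C" by (elim imageE)
    then have "C \<subseteq> {a..b}" unfolding snake_bases_def by blast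
    then show "C' \<in> bases (snake_path_matroid (b + 1 - a) (\<sigma> ` T))" using iff[of C] C by simp
  qed
qed

lemma coord_map_indicator:
  assumes fin: "finite I" and inj: "inj_on \<sigma> I" and C: "C \<subseteq> I" and \<sigma>C: "finite (\<sigma> ` C)"
    and x: "\<And>i. i \<in> I \<Longrightarrow> lookup x i + c i = of_bool (i \<in> C)"
  shows "coord_map I \<sigma> c x = indicator_vec (\<sigma> ` C)"
proof (rule poly_mapping_eqI)
  fix k
  show "lookup (coord_map I \<sigma> c x) k = lookup (indicator_vec (\<sigma> ` C)) k"
    unfolding lookup_indicator_vec[OF \<sigma>C]
  proof (cases "k \<in> \<sigma> ` I")
    case True
    then obtain i where i: "i \<in> I" "k = \<sigma> i" by blast
    then have "k \<in> \<sigma> ` C \<longleftrightarrow> i \<in> C" using C inj by (auto simp: inj_on_eq_iff subset_iff)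
    then show "lookup (coord_map I \<sigma> c x) k = of_bool (k \<in> \<sigma> ` C)"
      using lookup_coord_map(1)[OF fin inj i(1)] x[OF i(1)] i(2) by simp
  next
    case False
    then show "lookup (coord_map I \<sigma> c x) k = of_bool (k \<in> \<sigma> ` C)"
      using lookup_coord_map(2)[OF fin inj False] False C by auto
  qed
qed

text \<open>
  Translating by the indicator vector of \<open>B \<union> {b}\<close> turns the lattice points of the shard polytope
  into the indicator vectors of the bases of a snake matroid.
\<close>

lemma shard_polytope_equivalent_snake:
  assumes arc: "shard_arc n a b A B"
  shows "\<exists>N M. ground M = {1..N} \<and> snake_matroid M \<and>
    integrally_equivalent n (shard_polytope n a b A B) N (base_polytope M)"
proof -
  let ?T = "B \<union> {b}" and ?N = "b + 1 - a"
  define \<sigma> where "\<sigma> = (\<lambda>i. i - (a - 1))"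
  define M where "M = snake_path_matroid ?N (\<sigma> ` ?T)"
  let ?c = "\<lambda>i. of_bool (i \<in> ?T) :: real"
  let ?V = "shard_polytope n a b A B \<inter> int_lattice n"
  have ab: "1 \<le> a" "a < b" "b \<le> n" using arc unfolding shard_arc_def by auto
  note T = arc_north_subset[OF arc]
  have \<sigma>_inj: "inj_on \<sigma> {a..b}" unfolding \<sigma>_def inj_on_def using ab by auto
  have \<sigma>_range: "\<sigma> ` {a..b} \<subseteq> {1..?N}" unfolding \<sigma>_def using ab by auto
  have "snake_word ?N (\<sigma> ` ?T)" unfolding snake_word_def
  proof (intro conjI)
    show "\<sigma> ` ?T \<subseteq> {1..?N}" using T(1) \<sigma>_range by blast
    show "?N \<in> \<sigma> ` ?T" by (rule image_eqI[of _ _ b]) (use ab in \<open>auto simp: \<sigma>_def\<close>)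
    show "1 \<notin> \<sigma> ` ?T"
    proof
      assume "1 \<in> \<sigma> ` ?T"
      then obtain i where i: "i \<in> ?T" "\<sigma> i = 1" by force
      then have "i = a" using ab unfolding \<sigma>_def by linarith
      then show False using i T(2) by blast
    qed
  qed
  then have snake: "snake_matroid M" unfolding M_def by (rule snake_matroid_snake_path_matroid)
  have bM: "bases M = (\<lambda>C. \<sigma> ` C) ` snake_bases a b ?T"
    unfolding M_def \<sigma>_def by (rule snake_bases_shift[OF ab(1,2) T(1)])
  have V: "?V = (\<lambda>C. indicator_vec C - indicator_vec ?T) ` snake_bases a b ?T"
    by (rule shard_lattice_points[OF arc])
  have "coord_map {a..b} \<sigma> ?c (indicator_vec C - indicator_vec ?T) = indicator_vec (\<sigma> ` C)"
    if "C \<in> snake_bases a b ?T" for C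
  proof -
    have C: "C \<subseteq> {a..b}" using that unfolding snake_bases_def by blast
    have fin: "finite C" "finite ?T" using C T finite_subset by blast+
    have "lookup (indicator_vec C - indicator_vec ?T) i + ?c i = of_bool (i \<in> C)" for i
      by (simp only: lookup_minus lookup_indicator_vec[OF fin(1)] lookup_indicator_vec[OF fin(2)])
    then show ?thesis using fin by (intro coord_map_indicator[OF _ \<sigma>_inj C]) auto
  qed
  then have image: "coord_map {a..b} \<sigma> ?c ` ?V = indicator_vec ` bases M"
    unfolding V bM image_image by (intro image_cong) auto
  have "finite (snake_bases a b ?T)"
    by (rule finite_subset[of _ "Pow {a..b}"]) (auto simp: snake_bases_def)
  then have finV: "finite ?V" unfolding V by (rule finite_imageI)
  have "integrally_equivalent n (convex hull ?V) ?N (convex hull (coord_map {a..b} \<sigma> ?c ` ?V))"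
  proof (rule integrally_equivalent_coord_map[OF finV _ _ _ \<sigma>_inj \<sigma>_range])
    show "Poly_Mapping.keys x \<subseteq> {a..b}" if "x \<in> ?V" for x
      using that unfolding Int_iff shard_polytope_iff[OF arc] by blast
    show "{a..b} \<subseteq> {1..n}" using ab by auto
  qed simp_all
  then have "integrally_equivalent n (shard_polytope n a b A B) ?N (base_polytope M)"
    unfolding image shard_polytope_integral[OF arc, symmetric] base_polytope_def .
  moreover have "ground M = {1..?N}" unfolding M_def by simp
  ultimately show ?thesis using snake by blast
qed

text \<open>
  The isomorphism with a lattice path matroid permutes the coordinates; after undoing it, the
  inverse translation applies, with the arc whose set \<open>B\<close> consists of the north steps of the lower
  path other than the last one.
\<close>

lemma snake_equivalent_shard_polytope:
  assumes gM: "ground M = {1..N::nat}" and snake: "snake_matroid M"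
  shows "\<exists>n a b A B. shard_arc n a b A B \<and>
    integrally_equivalent N (base_polytope M) n (shard_polytope n a b A B)"
proof -
  obtain T g where T: "snake_word N T" and g: "bij_betw g {1..N} {1..N}"
    and bM: "bases M = (\<lambda>C. g ` C) ` bases (snake_path_matroid N T)"
    using snake_matroid_imp_snake_path_matroid[OF gM snake] .
  have T': "T \<subseteq> {1..N}" "1 \<notin> T" "N \<in> T" and N: "1 < N"
    using T unfolding snake_word_def by (auto simp: le_less)
  define A where "A = {2..N-1} - T"
  define B where "B = T - {N}"
  have TB: "B \<union> {N} = T" using T'(3) unfolding B_def by blast
  have inner: "2 \<le> i \<and> i \<le> N - 1" if "i \<in> B" for i
  proof -
    have "i \<noteq> 1" "i \<noteq> N" "1 \<le> i" "i \<le> N" using that T'(1,2) unfolding B_def by auto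
    then show ?thesis by linarith
  qed
  have arc: "shard_arc N 1 N A B"
    unfolding shard_arc_def
  proof (intro conjI)
    show "A \<union> B = {1 + 1..N - 1}"
    proof (intro set_eqI iffI)
      fix i assume "i \<in> A \<union> B"
      then show "i \<in> {1 + 1..N - 1}" using inner[of i] unfolding A_def by auto
    next
      fix i assume "i \<in> {1 + 1..N - 1}"
      then have "2 \<le> i" "i \<le> N - 1" "i \<noteq> N" using N by auto
      then show "i \<in> A \<union> B" unfolding A_def B_def by simp
    qed
    show "A \<inter> B = {}" unfolding A_def B_def by blast
  qed (use N in auto)
  define h where "h = inv_into {1..N} g"
  let ?c = "\<lambda>i. - of_bool (h i \<in> T) :: real" and ?V = "indicator_vec ` bases M"
  let ?SP = "shard_polytope N 1 N A B"
  have h: "bij_betw h {1..N} {1..N}" unfolding h_def by (rule bij_betw_inv_into[OF g])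
  have hg: "h (g i) = i" if "i \<in> {1..N}" for i
    unfolding h_def using bij_betw_inv_into_left[OF g that] .
  have gh: "g (h i) = i" if "i \<in> {1..N}" for i
    unfolding h_def using bij_betw_inv_into_right[OF g that] .
  have h_inj: "inj_on h {1..N}" and h_im: "h ` {1..N} = {1..N}" using h unfolding bij_betw_def by auto
  have g_im: "g ` {1..N} = {1..N}" using g unfolding bij_betw_def by auto
  have SB: "bases (snake_path_matroid N T) = snake_bases 1 N T"
    unfolding snake_path_matroid_def snake_bases_def by simp
  have finT: "finite T" using T'(1) finite_subset by blast
  have "coord_map {1..N} h ?c (indicator_vec (g ` C)) = indicator_vec C - indicator_vec T"
    if "C \<in> snake_bases 1 N T" for C
  proof (rule poly_mapping_eqI)
    fix k
    have C: "C \<subseteq> {1..N}" using that unfolding snake_bases_def by blast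
    have fin: "finite C" "finite (g ` C)" using C finite_subset by blast+
    show "lookup (coord_map {1..N} h ?c (indicator_vec (g ` C))) k =
        lookup (indicator_vec C - indicator_vec T) k"
      unfolding lookup_minus lookup_indicator_vec[OF fin(1)] lookup_indicator_vec[OF finT]
    proof (cases "k \<in> {1..N}")
      case True
      then have gk: "g k \<in> {1..N}" using g_im by blast
      have "g k \<in> g ` C \<longleftrightarrow> k \<in> C"
        using bij_betw_imp_inj_on[OF g] True C by (auto simp: inj_on_eq_iff subset_iff)
      then show "lookup (coord_map {1..N} h ?c (indicator_vec (g ` C))) k =
          of_bool (k \<in> C) - of_bool (k \<in> T)"
        using lookup_coord_map(1)[OF finite_atLeastAtMost h_inj gk, of ?c "indicator_vec (g ` C)"]
        unfolding lookup_indicator_vec[OF fin(2)] hg[OF True] by simp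
    next
      case False
      then have "k \<notin> h ` {1..N}" "k \<notin> C" "k \<notin> T" using h_im C T'(1) by blast+
      then show "lookup (coord_map {1..N} h ?c (indicator_vec (g ` C))) k =
          of_bool (k \<in> C) - of_bool (k \<in> T)"
        using lookup_coord_map(2)[OF finite_atLeastAtMost h_inj] by simp
    qed
  qed
  then have image: "coord_map {1..N} h ?c ` ?V = ?SP \<inter> int_lattice N"
    unfolding shard_lattice_points[OF arc] TB bM SB image_image by (intro image_cong) auto
  have sub: "C \<subseteq> {1..N}" if "C \<in> bases M" for C
  proof -
    from that obtain D where D: "D \<in> snake_bases 1 N T" "C = g ` D"
      unfolding bM SB by (elim imageE)
    then have "D \<subseteq> {1..N}" unfolding snake_bases_def by blast
    then show ?thesis unfolding D(2) using g_im by blast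
  qed
  have finV: "finite ?V"
    by (intro finite_imageI finite_subset[of "bases M" "Pow {1..N}"]) (use sub in auto)
  have keys: "Poly_Mapping.keys (indicator_vec C) \<subseteq> {1..N}" if "C \<in> bases M" for C
    using sub[OF that] finite_subset[OF sub[OF that]] lookup_indicator_vec[of C]
    by (auto simp del: lookup_sum simp: in_keys_iff)
  have "integrally_equivalent N (convex hull ?V) N (convex hull (coord_map {1..N} h ?c ` ?V))"
  proof (rule integrally_equivalent_coord_map[OF finV])
    show "?V \<subseteq> int_lattice N"
    proof
      fix x assume "x \<in> ?V"
      then obtain C where C: "C \<in> bases M" "x = indicator_vec C" by blast
      have "finite C" using sub[OF C(1)] finite_subset by blast
      then show "x \<in> int_lattice N"
        using keys[OF C(1)] unfolding int_lattice_def coord_space_def C(2)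
        by (simp only: mem_Collect_eq lookup_indicator_vec) simp
    qed
    show "Poly_Mapping.keys x \<subseteq> {1..N}" if "x \<in> ?V" for x using that keys by blast
  qed (use h_inj h_im in auto)
  then have "integrally_equivalent N (base_polytope M) N ?SP"
    unfolding image shard_polytope_integral[OF arc, symmetric] base_polytope_def .
  then show ?thesis using arc by blast
qed

theorem proposition5p10:
  shows "(\<forall>n a b A B. shard_arc n a b A B \<longrightarrow>
            (\<exists>N (M :: nat basis_system). ground M = {1..N} \<and> snake_matroid M \<and>
               integrally_equivalent n (shard_polytope n a b A B) N (base_polytope M))) \<and>
         (\<forall>N (M :: nat basis_system). ground M = {1..N} \<and> snake_matroid M \<longrightarrow>
            (\<exists>n a b A B. shard_arc n a b A B \<and>
               integrally_equivalent N (base_polytope M) n (shard_polytope n a b A B)))"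
  using shard_polytope_equivalent_snake snake_equivalent_shard_polytope by blast

end
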